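(* Let $\Omega_1$ and $\Omega_2$ be nonempty convex subsets of real vector spaces $Y_1$ and $Y_2$ (not necessarily finite dimensional) such that Hilbert's metric $\delta_H$ is well defined on each of them, and suppose that $\Omega_1$ and $\Omega_2$ are strictly convex. If $f\colon \Omega_1\to\Omega_2$ is an isometry of $(\Omega_1,\delta_H)$ into $(\Omega_2,\delta_H)$ (not assumed surjective), then $f$ is a projective linear homomorphism.
   Context: Hilbert's metric. Let $\Omega$ be a convex subset of a real vector space $Y$. Hilbert's metric is well defined on $\Omega$ if for all $x\neq y$ in $\Omega$ the straight line $\ell_{xy}$ through $x$ and $y$ is such that $\Omega\cap\ell_{xy}$ is an open and bounded line segment in $\ell_{xy}$. In that case, for $x\ne y$ in $\Omega$ let $x',y'$ be the end-points of the segment $\ell_{xy}\cap\Omega$, with $x$ between $x'$ and $y$, and $y$ between $y'$ and $x$, and put $$\delta_H(x,y)=\log\left(\frac{|x'-y|}{|x'-x|}\,\frac{|y'-x|}{|y'-y|}\right),\qquad \delta_H(x,x)=0,$$ where $|\cdot|$ is length along the line $\ell_{xy}$ (any norm on this line gives the same ratios). Order unit spaces. A cone $C$ in a real vector space $X$ is a convex set with $\lambda C\subseteq C$ for all $\lambda\ge 0$ and $C\cap(-C)=\{0\}$; write $x\le_C y$ if $y-x\in C$. $C$ is Archimedean if for each $x\in X$ and $y\in C$ with $nx\le_C y$ for all $n=1,2,\dots$ one has $x\le_C 0$. An element $u\in C$ is an order unit if for each $x\in X$ there is $\lambda>0$ with $x\le_C\lambda u$. An order unit space is a triple $(X,C,u)$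 with $C$ an Archimedean cone in $X$ and $u$ an order unit; it is equipped with the norm $\|x\|_u=\inf\{\lambda>0:-\lambda u\le_C x\le_C\lambda u\}$, and $C^\circ$ denotes the interior of $C$ for this norm. A strictly positive state is a linear functional $\varphi\colon X\to\mathbb{R}$ with $\varphi(x)>0$ for all $x\in C\setminus\{0\}$ and $\varphi(u)=1$. Put $\Sigma_\varphi=\{x\in C^\circ:\varphi(x)=1\}$; $\partial\Sigma_\varphi$ is the boundary of $\Sigma_\varphi$ relative to the affine space $\{x\in X:\varphi(x)=1\}$ in $(X,\|\cdot\|_u)$. Identification. Every nonempty convex set $\Omega$ on which $\delta_H$ is well defined is affinely isomorphic to $\Sigma_\varphi$ for some order unit space $(X,C,u)$ with strictly positive state $\varphi$. For $i=1,2$, the set $\Omega_i$ is identified via such an affine isomorphism with $\Sigma_{\varphi_i}$, where $\varphi_i$ is a strictly positive state on an order unit space $(X_i,C_i,u_i)$. Strict convexity. $\Omega_i$ is strictly convex if for all distinct $x,y\in\partial\Sigma_{\varphi_i}$ the open segment $(x,y)=\{tx+(1-t)y:0<t<1\}$ is contained in $\Sigma_{\varphi_i}$. Projective linear homomorphism. A linear map $T\colon X_1\to X_2$ is bi-positive if for all $x\in X_1$: $Tx\in C_2$ if and only if $x\in C_1$. Identifying $\Omega_i$ with $\Sigma_{\varphi_i}$ for $i=1,2$ via the chosen affine isomorphisms, an isometry $f$ of $\Omega_1\cong\Sigma_{\varphi_1}$ into $\Omega_2\cong\Sigma_{\varphi_2}$ is a projective linear homomorphism if there is a bi-positive linear map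 $T\colon X_1\to X_2$ such that $Tx\in C_2^\circ$ and $f(x)=Tx/\varphi_2(Tx)$ for all $x\in\Sigma_{\varphi_1}$. *)

theory Defs
  imports "HOL-Analysis.Analysis"
begin

section \<open>Hilbert's metric\<close>

text \<open>The line through \<open>x\<close> and \<open>y\<close> is \<open>affine hull {x, y}\<close>. For \<open>x \<noteq> y\<close> an
  \<open>open_segment a b\<close> that equals its trace on \<open>\<Omega>\<close> contains \<open>x\<close> and \<open>y\<close>, so automatically
  \<open>a \<noteq> b\<close> and both end-points lie on the line.\<close>

definition hilbert_well_defined :: "'a::real_vector set \<Rightarrow> bool" where
  "hilbert_well_defined \<Omega> \<longleftrightarrow>
     (\<forall>x\<in>\<Omega>. \<forall>y\<in>\<Omega>. x \<noteq> y \<longrightarrow> (\<exists>a b. \<Omega> \<inter> affine hull {x, y} = open_segment a b))"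

definition chord_ends :: "'a::real_vector set \<Rightarrow> 'a \<Rightarrow> 'a \<Rightarrow> 'a \<times> 'a" where
  "chord_ends \<Omega> x y =
     (THE (x', y'). \<Omega> \<inter> affine hull {x, y} = open_segment x' y' \<and>
        between (x', y) x \<and> between (y', x) y)"

text \<open>There is no norm on a bare real vector space. For \<open>p\<close>, \<open>q\<close> on the line through distinct
  \<open>x\<close> and \<open>y\<close>, the following is the length of the segment from \<open>p\<close> to \<open>q\<close> in the norm on that
  line for which the segment from \<open>x\<close> to \<open>y\<close> has length 1.\<close>

definition line_length :: "'a::real_vector \<Rightarrow> 'a \<Rightarrow> 'a \<Rightarrow> 'a \<Rightarrow> real" where
  "line_length x y p q = (THE r. \<exists>t. q - p = t *\<^sub>R (y - x) \<and> r = \<bar>t\<bar>)"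

definition hilbert_metric :: "'a::real_vector set \<Rightarrow> 'a \<Rightarrow> 'a \<Rightarrow> real" where
  "hilbert_metric \<Omega> x y =
     (if x = y then 0
      else let (x', y') = chord_ends \<Omega> x y; len = line_length x y
           in ln ((len x' y / len x' x) * (len y' x / len y' y)))"

definition hilbert_isometry ::
  "'a::real_vector set \<Rightarrow> 'b::real_vector set \<Rightarrow> ('a \<Rightarrow> 'b) \<Rightarrow> bool" where
  "hilbert_isometry \<Omega>\<^sub>1 \<Omega>\<^sub>2 f \<longleftrightarrow>
     f \<in> \<Omega>\<^sub>1 \<rightarrow> \<Omega>\<^sub>2 \<and>
     (\<forall>x\<in>\<Omega>\<^sub>1. \<forall>y\<in>\<Omega>\<^sub>1. hilbert_metric \<Omega>\<^sub>2 (f x) (f y) = hilbert_metric \<Omega>\<^sub>1 x y)"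


section \<open>Order unit spaces\<close>

text \<open>The vector space \<open>X\<close> of an order unit space is a linear subspace of a type. It is not
  required to be the whole type: the space belonging to a given convex set \<open>\<Omega>\<close> of type
  \<open>'a set\<close> can then be taken to be the span of \<open>\<Omega> \<times> {1}\<close> in the type \<open>'a \<times> real\<close>.
  The case of a whole type is \<open>X = UNIV\<close>.\<close>

definition linear_on :: "'a::real_vector set \<Rightarrow> ('a \<Rightarrow> 'b::real_vector) \<Rightarrow> bool" where
  "linear_on X T \<longleftrightarrow>
     (\<forall>x\<in>X. \<forall>y\<in>X. T (x + y) = T x + T y) \<and> (\<forall>c. \<forall>x\<in>X. T (c *\<^sub>R x) = c *\<^sub>R T x)"

definition cone_le :: "'a::real_vector set \<Rightarrow> 'a \<Rightarrow> 'a \<Rightarrow> bool" where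
  "cone_le C x y \<longleftrightarrow> y - x \<in> C"

definition pointed_cone :: "'a::real_vector set \<Rightarrow> bool" where
  "pointed_cone C \<longleftrightarrow> convex C \<and> cone C \<and> C \<inter> uminus ` C = {0}"

definition archimedean_cone :: "'a::real_vector set \<Rightarrow> 'a set \<Rightarrow> bool" where
  "archimedean_cone X C \<longleftrightarrow>
     (\<forall>x\<in>X. \<forall>y\<in>C. (\<forall>n::nat. 1 \<le> n \<longrightarrow> cone_le C (of_nat n *\<^sub>R x) y) \<longrightarrow> cone_le C x 0)"

definition is_order_unit :: "'a::real_vector set \<Rightarrow> 'a set \<Rightarrow> 'a \<Rightarrow> bool" where
  "is_order_unit X C u \<longleftrightarrow> u \<in> C \<and> (\<forall>x\<in>X. \<exists>l>0. cone_le C x (l *\<^sub>R u))"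

definition order_unit_space :: "'a::real_vector set \<Rightarrow> 'a set \<Rightarrow> 'a \<Rightarrow> bool" where
  "order_unit_space X C u \<longleftrightarrow>
     subspace X \<and> C \<subseteq> X \<and> pointed_cone C \<and> archimedean_cone X C \<and> is_order_unit X C u"

definition order_unit_norm :: "'a::real_vector set \<Rightarrow> 'a \<Rightarrow> 'a \<Rightarrow> real" where
  "order_unit_norm C u x = Inf {l. l > 0 \<and> cone_le C (- l *\<^sub>R u) x \<and> cone_le C x (l *\<^sub>R u)}"

text \<open>The values off \<open>X\<close> carry no meaning; they are set to 0 because the locale
  \<open>Metric_space\<close> demands symmetry and nonnegativity on the whole type.\<close>

definition order_unit_dist :: "'a::real_vector set \<Rightarrow> 'a set \<Rightarrow> 'a \<Rightarrow> 'a \<Rightarrow> 'a \<Rightarrow> real" where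
  "order_unit_dist X C u x y = (if x \<in> X \<and> y \<in> X then order_unit_norm C u (x - y) else 0)"

lemma order_unit_metric:
  assumes "order_unit_space X C u"
  shows "Metric_space X (order_unit_dist X C u)"
proof -
  have X: "subspace X" and CX: "C \<subseteq> X" and cv: "convex C" and cC: "cone C"
    and pt: "C \<inter> uminus ` C = {0}"
    and ar: "\<And>x y. x\<in>X \<Longrightarrow> y\<in>C \<Longrightarrow> (\<And>n::nat. 1 \<le> n \<Longrightarrow> y - of_nat n *\<^sub>R x \<in> C) \<Longrightarrow> - x \<in> C"
    and uC: "u \<in> C" and ou: "\<And>x. x\<in>X \<Longrightarrow> \<exists>l>0. l *\<^sub>R u - x \<in> C"
    using assms unfolding order_unit_space_def pointed_cone_def archimedean_cone_def is_order_unit_def cone_le_def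
    by (simp_all, blast+)
  define S where "S x = {l. l > 0 \<and> x + l *\<^sub>R u \<in> C \<and> l *\<^sub>R u - x \<in> C}" for x
  have N: "order_unit_norm C u x = Inf (S x)" for x
    by (simp add: order_unit_norm_def cone_le_def S_def)
  have add: "a + b \<in> C" if "a \<in> C" "b \<in> C" for a b
    using cv cC convex_cone that by blast
  have sc: "c *\<^sub>R a \<in> C" if "a \<in> C" "c \<ge> 0" for a c
    using cC that by (auto simp: cone_def)
  have bb: "bdd_below (S x)" for x by (rule bdd_belowI[of _ 0]) (auto simp: S_def)
  have up: "m \<in> S x" if "l \<in> S x" "l \<le> m" for l m x
    using that add[OF _ sc[OF uC, of "m - l"]] unfolding S_def
    by (force simp: algebra_simps)
  have ne: "S x \<noteq> {}" if x: "x \<in> X" for x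
  proof -
    obtain l m where "l>0" "l *\<^sub>R u - x \<in> C" "m>0" "m *\<^sub>R u - (- x) \<in> C"
      using ou[OF x] ou[of "-x"] subspace_neg[OF X x] by blast
    then have "l + m \<in> S x" unfolding S_def
      using add[OF _ sc[OF uC, of l], of "m *\<^sub>R u - (- x)"] add[OF _ sc[OF uC, of m], of "l *\<^sub>R u - x"]
      by (auto simp: algebra_simps)
    then show ?thesis by auto
  qed
  have nn: "0 \<le> Inf (S x)" if "x \<in> X" for x
    by (rule cInf_greatest[OF ne[OF that]]) (auto simp: S_def)
  have small: "l \<in> S x" if "x \<in> X" "Inf (S x) < l" for x l
    using cInf_lessD[OF ne[OF that(1)] that(2)] up by force
  have sym: "S (- x) = S x" for x by (auto simp: S_def algebra_simps)
  have zero: "x = 0" if x: "x \<in> X" and "Inf (S x) = 0" for x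
  proof -
    have *: "(1 / real n) \<in> S x" if "n \<ge> 1" for n :: nat
      using small[OF x] that \<open>Inf (S x) = 0\<close> by simp
    have "u - of_nat n *\<^sub>R x \<in> C" "u - of_nat n *\<^sub>R (- x) \<in> C" if "n \<ge> 1" for n :: nat
      using *[OF that] sc[of "(1/n) *\<^sub>R u - x" n] sc[of "x + (1/n) *\<^sub>R u" n] that
      by (auto simp: S_def algebra_simps)
    then have "- x \<in> C" "- (- x) \<in> C" using ar[OF x uC] ar[OF subspace_neg[OF X x] uC] by auto
    then have "x \<in> C \<inter> uminus ` C" by (auto intro: image_eqI[of _ _ "-x"])
    then show ?thesis using pt by auto
  qed
  have S0: "Inf (S 0) = 0"
  proof -
    have "S 0 = {0<..}" using sc[OF uC] by (auto simp: S_def)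
    then show ?thesis by simp
  qed
  have plus: "l + m \<in> S (x + y)" if "l \<in> S x" "m \<in> S y" for l m x y
    using that add[of "x + l *\<^sub>R u" "y + m *\<^sub>R u"] add[of "l *\<^sub>R u - x" "m *\<^sub>R u - y"]
    by (simp add: S_def algebra_simps)
  have tri: "Inf (S (x + y)) \<le> Inf (S x) + Inf (S y)" if "x \<in> X" "y \<in> X" for x y
  proof (rule field_le_epsilon)
    fix e :: real assume "e > 0"
    have "Inf (S x) + e/2 \<in> S x" "Inf (S y) + e/2 \<in> S y"
      using small that \<open>e>0\<close> by auto
    then have "(Inf (S x) + e/2) + (Inf (S y) + e/2) \<in> S (x+y)"
      by (rule plus)
    then show "Inf (S (x + y)) \<le> Inf (S x) + Inf (S y) + e"
      using cInf_lower[OF _ bb] by force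
  qed
  show ?thesis
  proof
    fix x y z
    show "0 \<le> order_unit_dist X C u x y"
      using nn[of "x - y"] subspace_diff[OF X] by (simp add: order_unit_dist_def N)
    show "order_unit_dist X C u x y = order_unit_dist X C u y x"
      using sym[of "x - y"] by (simp add: order_unit_dist_def N)
    assume x: "x \<in> X" and y: "y \<in> X"
    then show "order_unit_dist X C u x y = 0 \<longleftrightarrow> x = y"
      using zero[of "x - y"] S0 subspace_diff[OF X] by (auto simp: order_unit_dist_def N)
    assume z: "z \<in> X"
    show "order_unit_dist X C u x z \<le> order_unit_dist X C u x y + order_unit_dist X C u y z"
      using tri[of "x - y" "y - z"] x y z subspace_diff[OF X] by (simp add: order_unit_dist_def N)
  qed
qed

definition order_unit_topology :: "'a::real_vector set \<Rightarrow> 'a set \<Rightarrow> 'a \<Rightarrow> 'a topology" where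
  "order_unit_topology X C u = Metric_space.mtopology X (order_unit_dist X C u)"

definition cone_interior :: "'a::real_vector set \<Rightarrow> 'a set \<Rightarrow> 'a \<Rightarrow> 'a set" where
  "cone_interior X C u = order_unit_topology X C u interior_of C"

definition strictly_positive_state ::
  "'a::real_vector set \<Rightarrow> 'a set \<Rightarrow> 'a \<Rightarrow> ('a \<Rightarrow> real) \<Rightarrow> bool" where
  "strictly_positive_state X C u \<phi> \<longleftrightarrow> linear_on X \<phi> \<and> (\<forall>x\<in>C - {0}. \<phi> x > 0) \<and> \<phi> u = 1"

definition state_section ::
  "'a::real_vector set \<Rightarrow> 'a set \<Rightarrow> 'a \<Rightarrow> ('a \<Rightarrow> real) \<Rightarrow> 'a set" where
  "state_section X C u \<phi> = {x \<in> cone_interior X C u. \<phi> x = 1}"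

definition section_boundary ::
  "'a::real_vector set \<Rightarrow> 'a set \<Rightarrow> 'a \<Rightarrow> ('a \<Rightarrow> real) \<Rightarrow> 'a set" where
  "section_boundary X C u \<phi> =
     subtopology (order_unit_topology X C u) {x \<in> X. \<phi> x = 1} frontier_of state_section X C u \<phi>"

definition strictly_convex_section ::
  "'a::real_vector set \<Rightarrow> 'a set \<Rightarrow> 'a \<Rightarrow> ('a \<Rightarrow> real) \<Rightarrow> bool" where
  "strictly_convex_section X C u \<phi> \<longleftrightarrow>
     (\<forall>x\<in>section_boundary X C u \<phi>. \<forall>y\<in>section_boundary X C u \<phi>. x \<noteq> y \<longrightarrow>
        open_segment x y \<subseteq> state_section X C u \<phi>)"


section \<open>Identification and projective linear homomorphisms\<close>

definition affine_isomorphism ::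
  "'a::real_vector set \<Rightarrow> 'b::real_vector set \<Rightarrow> ('a \<Rightarrow> 'b) \<Rightarrow> bool" where
  "affine_isomorphism A B g \<longleftrightarrow>
     bij_betw g A B \<and>
     (\<forall>x\<in>A. \<forall>y\<in>A. \<forall>t\<in>{0..1}. g ((1 - t) *\<^sub>R x + t *\<^sub>R y) = (1 - t) *\<^sub>R g x + t *\<^sub>R g y)"

definition bipositive ::
  "'a::real_vector set \<Rightarrow> 'a set \<Rightarrow> 'b::real_vector set \<Rightarrow> ('a \<Rightarrow> 'b) \<Rightarrow> bool" where
  "bipositive X\<^sub>1 C\<^sub>1 C\<^sub>2 T \<longleftrightarrow> (\<forall>x\<in>X\<^sub>1. T x \<in> C\<^sub>2 \<longleftrightarrow> x \<in> C\<^sub>1)"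

definition projective_linear_hom ::
  "'a::real_vector set \<Rightarrow> 'a set \<Rightarrow> 'a \<Rightarrow> ('a \<Rightarrow> real) \<Rightarrow>
   'b::real_vector set \<Rightarrow> 'b set \<Rightarrow> 'b \<Rightarrow> ('b \<Rightarrow> real) \<Rightarrow> ('a \<Rightarrow> 'b) \<Rightarrow> bool" where
  "projective_linear_hom X\<^sub>1 C\<^sub>1 u\<^sub>1 \<phi>\<^sub>1 X\<^sub>2 C\<^sub>2 u\<^sub>2 \<phi>\<^sub>2 F \<longleftrightarrow>
     (\<exists>T. T \<in> X\<^sub>1 \<rightarrow> X\<^sub>2 \<and> linear_on X\<^sub>1 T \<and> bipositive X\<^sub>1 C\<^sub>1 C\<^sub>2 T \<and>
        (\<forall>x\<in>state_section X\<^sub>1 C\<^sub>1 u\<^sub>1 \<phi>\<^sub>1.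
           T x \<in> cone_interior X\<^sub>2 C\<^sub>2 u\<^sub>2 \<and> F x = T x /\<^sub>R \<phi>\<^sub>2 (T x)))"

end

theory Submission
  imports Defs
begin

text \<open>
  With \<open>M x y\<close> the least \<open>b\<close> such that \<open>x \<le>\<^sub>C b y\<close>, Hilbert's metric of a section of the cone is
  \<open>D x y = ln (M x y * M y x)\<close>. Strict convexity of the target forces equality in the triangle
  inequality to occur only on lines, so the isometry sends collinear points to collinear points.
  In the plane spanned by boundary rays \<open>a\<close>, \<open>b\<close> the metric compares the ratios of the
  coordinates of two points, so the isometry is, up to positive multiples, linear on every plane
  through a fixed interior point \<open>u\<close>. Normalised to agree at \<open>u\<close>, these linear maps glue to a
  map \<open>T\<close>. It is additive because \<open>T (z + w) + (s + r) T u\<close> lies in the span of \<open>T z + s T u\<close>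
  and \<open>T w + r T u\<close> for all large \<open>s\<close> and \<open>r\<close>, which determines all coefficients.
\<close>

text \<open>If \<open>D\<close> is additive along \<open>x\<close>, \<open>y\<close>,
  \<open>z\<close>, then a positive combination of two boundary vectors of the cone stays on the
  boundary. In a strictly convex section this happens only if the two are parallel or one vanishes,
  and either case is a linear relation between \<open>x\<close>, \<open>y\<close> and
  \<open>z\<close>. Distances ignore scaling and give the coordinate ratio on a chord only up to
  inversion. So the isometry is controlled on rays only, and a second reference point on each chord
  is needed to fix its orientation. The planes through \<open>u\<close> meet only in the line of
  \<open>u\<close>; for a sum leaving them, all that is known at first is one span relation.
  Bipositivity is read off plane by plane: there both cones are quadrants with matching
  coordinates.\<close>

lemma mult_eq_imp_eq_of_le:
  fixes a b p q :: real
  assumes "0 < a" "0 < b" "a \<le> p" "b \<le> q" "a * b = p * q"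
  shows "a = p \<and> b = q"
proof -
  have "a * b \<le> p * b" "p * b \<le> p * q"
    using assms(1-4) by (intro mult_right_mono mult_left_mono; simp)+
  then have p: "p = a" using assms by simp
  then have "a * b = a * q" using assms by simp
  then show ?thesis using p assms by simp
qed

lemma scaleR_eq_scaleR_imp:
  fixes x y :: "'a::real_vector"
  assumes "c *\<^sub>R x = d *\<^sub>R y" "c \<noteq> 0"
  shows "x = (d / c) *\<^sub>R y"
proof -
  have "(1 / c) *\<^sub>R c *\<^sub>R x = (1 / c) *\<^sub>R d *\<^sub>R y" using assms by simp
  then show ?thesis using assms(2) by simp
qed

lemma span_pairE:
  fixes x :: "'a::real_vector"
  assumes "x \<in> span {a, b}"
  obtains k l where "x = k *\<^sub>R a + l *\<^sub>R b"
proof -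
  obtain k where "x - k *\<^sub>R a \<in> span {b}"
    using assms unfolding span_breakdown_eq[of x a "{b}"] by blast
  then obtain l where "x - k *\<^sub>R a = l *\<^sub>R b" by (auto simp: span_singleton)
  then show thesis using that[of k l] by (simp add: diff_eq_eq add.commute)
qed

section \<open>Order unit spaces with a strictly positive state\<close>

locale state_space =
  fixes X C :: "'a::real_vector set" and u :: 'a and \<phi> :: "'a \<Rightarrow> real"
  assumes ous: "order_unit_space X C u"
    and state: "strictly_positive_state X C u \<phi>"
begin

abbreviation K :: "'a set" where "K \<equiv> cone_interior X C u"

lemma subspace_X: "subspace X" and C_subset: "C \<subseteq> X"
  using ous by (auto simp: order_unit_space_def)

lemma X_closed [simp]:
  "x \<in> X \<Longrightarrow> y \<in> X \<Longrightarrow> x + y \<in> X" "x \<in> X \<Longrightarrow> y \<in> X \<Longrightarrow> x - y \<in> X"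
  "x \<in> X \<Longrightarrow> c *\<^sub>R x \<in> X" "x \<in> X \<Longrightarrow> - x \<in> X" "0 \<in> X" "x \<in> C \<Longrightarrow> x \<in> X"
  using subspace_X C_subset
  by (auto simp: subspace_add subspace_diff subspace_scale subspace_neg subspace_0)

lemma C_add: "x \<in> C \<Longrightarrow> y \<in> C \<Longrightarrow> x + y \<in> C"
  and C_scale: "x \<in> C \<Longrightarrow> c \<ge> 0 \<Longrightarrow> c *\<^sub>R x \<in> C"
  and u_in_C: "u \<in> C"
  and order_unit_bound: "x \<in> X \<Longrightarrow> \<exists>l>0. l *\<^sub>R u - x \<in> C"
proof -
  have "convex C" "cone C" using ous by (auto simp: order_unit_space_def pointed_cone_def)
  then show "x \<in> C \<Longrightarrow> y \<in> C \<Longrightarrow> x + y \<in> C" "x \<in> C \<Longrightarrow> c \<ge> 0 \<Longrightarrow> c *\<^sub>R x \<in> C"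
    using convex_cone by (blast, auto simp: cone_def)
  show "u \<in> C" "x \<in> X \<Longrightarrow> \<exists>l>0. l *\<^sub>R u - x \<in> C"
    using ous by (auto simp: order_unit_space_def is_order_unit_def cone_le_def)
qed

lemma phi_linear [simp]:
  "x \<in> X \<Longrightarrow> y \<in> X \<Longrightarrow> \<phi> (x + y) = \<phi> x + \<phi> y" "x \<in> X \<Longrightarrow> \<phi> (c *\<^sub>R x) = c * \<phi> x"
  using state by (auto simp: strictly_positive_state_def linear_on_def)

lemma phi_simps [simp]:
  "\<phi> u = 1" "x \<in> X \<Longrightarrow> \<phi> (- x) = - \<phi> x" "x \<in> X \<Longrightarrow> y \<in> X \<Longrightarrow> \<phi> (x - y) = \<phi> x - \<phi> y" "\<phi> 0 = 0"
proof -
  show *: "\<phi> (- x) = - \<phi> x" if "x \<in> X" for x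
    using phi_linear(2)[OF that, of "-1"] by simp
  show "\<phi> (x - y) = \<phi> x - \<phi> y" if "x \<in> X" "y \<in> X"
    using phi_linear(1)[of x "- y"] that * by simp
  show "\<phi> 0 = 0" using phi_linear(2)[of 0 0] by simp
qed (use state in \<open>simp add: strictly_positive_state_def\<close>)

lemma phi_pos: "x \<in> C \<Longrightarrow> x \<noteq> 0 \<Longrightarrow> \<phi> x > 0"
  using state by (auto simp: strictly_positive_state_def)

lemma phi_nonneg: "x \<in> C \<Longrightarrow> \<phi> x \<ge> 0"
  using phi_pos[of x] by (cases "x = 0") auto

text \<open>Multiplying the hypothesis at \<open>e = 1 / n\<close> by \<open>n\<close> bounds
  \<open>n\<close> times \<open>- x\<close> by \<open>y\<close>, so the Archimedean axiom applies to
  \<open>- x\<close>.\<close>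

lemma C_closed:
  assumes "x \<in> X" "y \<in> C" "\<And>e. e > 0 \<Longrightarrow> x + e *\<^sub>R y \<in> C"
  shows "x \<in> C"
proof -
  have "y - of_nat n *\<^sub>R (- x) \<in> C" if "1 \<le> n" for n :: nat
    using C_scale[OF assms(3)[of "1 / n"], of n] that by (simp add: algebra_simps)
  then show ?thesis
    using ous assms(1,2) unfolding order_unit_space_def archimedean_cone_def cone_le_def
    by (metis X_closed(4) diff_0 minus_minus)
qed

lemma order_unit_dist_less:
  assumes "x \<in> X" "y \<in> X" "l > 0" "l < r" "l *\<^sub>R u + (x - y) \<in> C" "l *\<^sub>R u - (x - y) \<in> C"
  shows "order_unit_dist X C u x y < r"
proof -
  have "order_unit_norm C u (x - y) \<le> l"
    unfolding order_unit_norm_def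
    by (rule cInf_lower) (use assms in \<open>auto simp: cone_le_def algebra_simps intro!: bdd_belowI[of _ 0]\<close>)
  then show ?thesis using assms by (simp add: order_unit_dist_def)
qed

lemma order_unit_dist_lessD:
  assumes "x \<in> X" "y \<in> X" "order_unit_dist X C u x y < r"
  shows "y - x + r *\<^sub>R u \<in> C"
proof -
  define S where "S = {l. l > 0 \<and> cone_le C (- l *\<^sub>R u) (x - y) \<and> cone_le C (x - y) (l *\<^sub>R u)}"
  have "S \<noteq> {}"
  proof -
    obtain l m where l: "l > 0" "l *\<^sub>R u - (x - y) \<in> C" and m: "m > 0" "m *\<^sub>R u - (y - x) \<in> C"
      using order_unit_bound[of "x - y"] order_unit_bound[of "y - x"] assms by auto
    have "l + m \<in> S"
      using l m C_add[OF l(2) C_scale[OF u_in_C, of m]] C_add[OF m(2) C_scale[OF u_in_C, of l]]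
      by (auto simp: S_def cone_le_def algebra_simps)
    then show ?thesis by auto
  qed
  moreover have "Inf S < r" using assms by (simp add: S_def order_unit_dist_def order_unit_norm_def)
  ultimately obtain l where "l \<in> S" "l < r" using cInf_lessD by blast
  then show ?thesis
    using C_add[OF _ C_scale[OF u_in_C, of "r - l"], of "l *\<^sub>R u - (x - y)"]
    by (simp add: S_def cone_le_def algebra_simps)
qed

text \<open>This replaces the norm interior by an algebraic condition. A point \<open>y\<close> of
  the ball of radius \<open>e\<close> about \<open>x\<close> is the sum of
  \<open>y - x + e *\<^sub>R u\<close> and \<open>x - e *\<^sub>R u\<close>, both in the cone. The
  topology is needed again only for the boundary of the section.\<close>

lemma K_iff: "x \<in> K \<longleftrightarrow> x \<in> X \<and> (\<exists>e>0. x - e *\<^sub>R u \<in> C)"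
proof -
  interpret Metric_space X "order_unit_dist X C u" by (rule order_unit_metric[OF ous])
  have K: "x \<in> K \<longleftrightarrow> (\<exists>r>0. x \<in> X \<and> mball x r \<subseteq> C)"
  proof
    assume "x \<in> K"
    then obtain T where "openin mtopology T" "x \<in> T" "T \<subseteq> C"
      by (auto simp: cone_interior_def order_unit_topology_def interior_of_def)
    then show "\<exists>r>0. x \<in> X \<and> mball x r \<subseteq> C" unfolding openin_mtopology by blast
  next
    assume "\<exists>r>0. x \<in> X \<and> mball x r \<subseteq> C"
    then show "x \<in> K"
      unfolding cone_interior_def order_unit_topology_def interior_of_def
      using openin_mball centre_in_mball_iff by blast
  qed
  show ?thesis
  proof
    assume "x \<in> K"
    then obtain r where r: "r > 0" "x \<in> X" "mball x r \<subseteq> C" using K by blast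
    have "x - (r/2) *\<^sub>R u \<in> mball x r"
    proof -
      have "(r/2) *\<^sub>R u + (r/2) *\<^sub>R u \<in> C" "0 \<in> C"
        using r C_scale[OF u_in_C, of 0] by (simp_all add: C_add C_scale u_in_C)
      then have "order_unit_dist X C u x (x - (r/2) *\<^sub>R u) < r"
        using r u_in_C by (intro order_unit_dist_less[of _ _ "r/2"]) simp_all
      then show ?thesis using r u_in_C by (simp add: in_mball)
    qed
    then show "x \<in> X \<and> (\<exists>e>0. x - e *\<^sub>R u \<in> C)" using r by (intro conjI exI[of _ "r/2"]) auto
  next
    assume "x \<in> X \<and> (\<exists>e>0. x - e *\<^sub>R u \<in> C)"
    then obtain e where e: "x \<in> X" "e > 0" "x - e *\<^sub>R u \<in> C" by auto
    have "y \<in> C" if "y \<in> mball x e" for y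
      using C_add[OF order_unit_dist_lessD[of x y e] e(3)] that by (auto simp: in_mball)
    then show "x \<in> K" using K e by blast
  qed
qed

lemma K_subset_C: "x \<in> K \<Longrightarrow> x \<in> C"
proof -
  assume "x \<in> K"
  then obtain e where "e > 0" "x - e *\<^sub>R u \<in> C" by (auto simp: K_iff)
  then show "x \<in> C" using C_add[OF _ C_scale[OF u_in_C, of e]] by force
qed

lemma K_X [simp]: "x \<in> K \<Longrightarrow> x \<in> X" by (simp add: K_iff)

lemma K_add_C: "x \<in> K \<Longrightarrow> y \<in> C \<Longrightarrow> x + y \<in> K"
proof -
  assume "x \<in> K" "y \<in> C"
  then obtain e where "x \<in> X" "e > 0" "(x - e *\<^sub>R u) + y \<in> C" by (auto simp: K_iff intro: C_add)
  moreover have "(x - e *\<^sub>R u) + y = (x + y) - e *\<^sub>R u" by simp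
  ultimately show "x + y \<in> K" using \<open>y \<in> C\<close> by (metis K_iff X_closed(1,6))
qed

lemma K_add: "x \<in> K \<Longrightarrow> y \<in> K \<Longrightarrow> x + y \<in> K"
  using K_add_C K_subset_C by blast

lemma K_scale:
  assumes "x \<in> K" "c > 0" shows "c *\<^sub>R x \<in> K"
proof -
  obtain e where "e > 0" "x - e *\<^sub>R u \<in> C" using assms by (auto simp: K_iff)
  then have "c * e > 0" "c *\<^sub>R x - (c * e) *\<^sub>R u \<in> C"
    using assms C_scale[of "x - e *\<^sub>R u" c] by (auto simp: algebra_simps)
  then show ?thesis using assms by (auto simp: K_iff)
qed

lemma K_scale_iff: "c > 0 \<Longrightarrow> c *\<^sub>R x \<in> K \<longleftrightarrow> x \<in> K"
  using K_scale[of x c] K_scale[of "c *\<^sub>R x" "1/c"] by auto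

lemma C_scale_iff: "c > 0 \<Longrightarrow> c *\<^sub>R x \<in> C \<longleftrightarrow> x \<in> C"
  using C_scale[of x c] C_scale[of "c *\<^sub>R x" "1/c"] by auto

lemma u_in_K: "u \<in> K"
proof -
  have "u - 1 *\<^sub>R u \<in> C" using C_scale[OF u_in_C, of 0] by simp
  then show ?thesis unfolding K_iff using u_in_C zero_less_one by (metis X_closed(6))
qed

lemma zero_notin_K: "0 \<notin> K"
proof
  assume "0 \<in> K"
  then obtain e where "e > 0" "- (e *\<^sub>R u) \<in> C" by (auto simp: K_iff)
  then show False using phi_nonneg[of "- (e *\<^sub>R u)"] u_in_C by simp
qed

lemma phi_K: "x \<in> K \<Longrightarrow> \<phi> x > 0"
  using phi_pos K_subset_C zero_notin_K by blast

lemma K_absorbs: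
  assumes "x \<in> K" "y \<in> X" shows "\<exists>e>0. x - e *\<^sub>R y \<in> K"
proof -
  obtain e where e: "e > 0" "x - e *\<^sub>R u \<in> C" using assms by (auto simp: K_iff)
  obtain l where l: "l > 0" "l *\<^sub>R u - y \<in> C" using order_unit_bound assms by blast
  \<comment> \<open>Only half of the margin \<open>e\<close> is spent on \<open>y\<close>; the other
    half keeps the result in the interior.\<close>
  have "(x - e *\<^sub>R u) + (e / (2*l)) *\<^sub>R (l *\<^sub>R u - y) \<in> C"
    using e l by (intro C_add C_scale) auto
  moreover have "(x - e *\<^sub>R u) + (e / (2*l)) *\<^sub>R (l *\<^sub>R u - y) = (x - (e/(2*l)) *\<^sub>R y) - (e/2) *\<^sub>R u"
  proof -
    have "e *\<^sub>R u = (e/2) *\<^sub>R u + (e/2) *\<^sub>R u" by (simp flip: scaleR_left.add)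
    then show ?thesis using l by (simp add: scaleR_diff_right)
  qed
  ultimately have "(x - (e/(2*l)) *\<^sub>R y) \<in> K" using e assms by (auto simp: K_iff intro!: exI[of _ "e/2"])
  then show ?thesis using e l by (intro exI[of _ "e/(2*l)"]) auto
qed

text \<open>Through this shift, facts about interior points reach arbitrary vectors of
  \<open>X\<close>.\<close>

lemma K_absorbs_large:
  assumes "x \<in> K" "y \<in> X" shows "\<exists>s0>0. \<forall>s\<ge>s0. s *\<^sub>R x + y \<in> K"
proof -
  obtain e where e: "e > 0" "x - e *\<^sub>R (- y) \<in> K" using K_absorbs[of x "- y"] assms by auto
  have "s *\<^sub>R x + y \<in> K" if "s \<ge> 1/e" for s
  proof -
    have "(1/e) *\<^sub>R (x - e *\<^sub>R (-y)) + (s - 1/e) *\<^sub>R x \<in> K"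
      using K_scale[OF e(2), of "1/e"] C_scale[OF K_subset_C[OF assms(1)], of "s - 1/e"] e that
      by (intro K_add_C) auto
    then show ?thesis using e by (simp add: algebra_simps)
  qed
  then show ?thesis using e by (intro exI[of _ "1/e"]) auto
qed

section \<open>Domination constants and the metric \<open>D\<close> on the open cone\<close>

definition M :: "'a \<Rightarrow> 'a \<Rightarrow> real" where "M x y = Inf {b. b *\<^sub>R y - x \<in> C}"

text \<open>The admissible \<open>b\<close> form a closed half-line: absorption makes the set
  nonempty, the state bounds it below, and \<open>C_closed\<close> puts the infimum in it. From here
  on \<open>M\<close> is handled through this equivalence.\<close>

lemma M_le_iff:
  assumes x: "x \<in> X" and y: "y \<in> K"
  shows "M x y \<le> b \<longleftrightarrow> b *\<^sub>R y - x \<in> C"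
proof -
  define S where "S = {b. b *\<^sub>R y - x \<in> C}"
  have bb: "bdd_below S"
  proof (rule bdd_belowI)
    fix b assume "b \<in> S"
    then have "0 \<le> \<phi> (b *\<^sub>R y - x)" using phi_nonneg by (auto simp: S_def)
    then show "\<phi> x / \<phi> y \<le> b" using x y phi_K[OF y] by (simp add: field_simps)
  qed
  obtain s where "s *\<^sub>R y + (- x) \<in> K" using K_absorbs_large[of y "- x"] x y by auto
  then have ne: "S \<noteq> {}" using K_subset_C by (auto simp: S_def)
  have up: "c \<in> S" if "b \<in> S" "b \<le> c" for b c
    using C_add[OF _ C_scale[OF K_subset_C[OF y], of "c - b"], of "b *\<^sub>R y - x"] that
    by (auto simp: S_def algebra_simps)
  have "Inf S \<in> S"
  proof -
    have "Inf S *\<^sub>R y - x + e *\<^sub>R y \<in> C" if e: "e > 0" for e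
    proof -
      have "Inf S < Inf S + e" using e by simp
      then obtain b where "b \<in> S" "b < Inf S + e" using cInf_lessD[OF ne] by blast
      then have "Inf S + e \<in> S" using up by simp
      then show ?thesis by (simp add: S_def algebra_simps)
    qed
    then show ?thesis using C_closed[of "Inf S *\<^sub>R y - x" y] x y K_subset_C by (auto simp: S_def)
  qed
  then have "Inf S \<le> b \<longleftrightarrow> b \<in> S" using up cInf_lower[OF _ bb] by blast
  then show ?thesis by (simp add: M_def S_def)
qed

lemma M_less_iff:
  assumes x: "x \<in> X" and y: "y \<in> K"
  shows "M x y < b \<longleftrightarrow> b *\<^sub>R y - x \<in> K"
proof
  assume "M x y < b"
  then have "(b - M x y) *\<^sub>R y + (M x y *\<^sub>R y - x) \<in> K"
    using M_le_iff[OF x y, of "M x y"] K_scale[OF y] by (intro K_add_C) auto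
  then show "b *\<^sub>R y - x \<in> K" by (simp add: algebra_simps)
next
  assume "b *\<^sub>R y - x \<in> K"
  then obtain e where "e > 0" "(b *\<^sub>R y - x) - e *\<^sub>R y \<in> K" using K_absorbs y by (meson K_X)
  then have "(b - e) *\<^sub>R y - x \<in> C" using K_subset_C by (force simp: algebra_simps)
  then show "M x y < b" using M_le_iff[OF x y, of "b - e"] \<open>e > 0\<close> by simp
qed

text \<open>The vector \<open>M x y *\<^sub>R y - x\<close> is on the boundary of the cone. Strict
  convexity will be applied to vectors of this form.\<close>

lemma M_attained: "x \<in> X \<Longrightarrow> y \<in> K \<Longrightarrow> M x y *\<^sub>R y - x \<in> C"
  and M_boundary: "x \<in> X \<Longrightarrow> y \<in> K \<Longrightarrow> M x y *\<^sub>R y - x \<notin> K"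
  using M_le_iff[of x y "M x y"] M_less_iff[of x y "M x y"] by auto

lemma M_ge_phi: "x \<in> X \<Longrightarrow> y \<in> K \<Longrightarrow> \<phi> x \<le> M x y * \<phi> y"
  using phi_nonneg[OF M_attained[of x y]] by simp

text \<open>The state vanishes on \<open>M x y *\<^sub>R y - x\<close>, an element of the cone, and
  a strictly positive state vanishes there only at \<open>0\<close>.\<close>

lemma M_eq_phi:
  assumes "x \<in> X" "y \<in> K" "\<phi> x = M x y * \<phi> y"
  shows "x = M x y *\<^sub>R y"
  using phi_pos[OF M_attained[of x y]] assms by force

lemma M_pos: "x \<in> K \<Longrightarrow> y \<in> K \<Longrightarrow> M x y > 0"
  by (meson K_X M_ge_phi phi_K less_le_trans zero_less_mult_pos2)

lemma M_eqI:
  assumes "x \<in> X" "y \<in> K" "\<And>b. b *\<^sub>R y - x \<in> C \<longleftrightarrow> c \<le> b"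
  shows "M x y = c"
  using M_le_iff[OF assms(1,2)] assms(3) by (metis order_refl order_antisym)

lemma M_scale:
  assumes "x \<in> X" "y \<in> K" "c > 0" "d > 0"
  shows "M (c *\<^sub>R x) (d *\<^sub>R y) = c / d * M x y"
proof (rule M_eqI)
  fix b
  have "b *\<^sub>R d *\<^sub>R y - c *\<^sub>R x = c *\<^sub>R ((b * d / c) *\<^sub>R y - x)" using assms by (simp add: algebra_simps)
  then have "b *\<^sub>R d *\<^sub>R y - c *\<^sub>R x \<in> C \<longleftrightarrow> M x y \<le> b * d / c"
    using assms C_scale_iff M_le_iff by simp
  then show "b *\<^sub>R d *\<^sub>R y - c *\<^sub>R x \<in> C \<longleftrightarrow> c / d * M x y \<le> b"
    using assms by (simp add: field_simps)
qed (use assms K_scale in auto)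

text \<open>A telescoping identity. It gives submultiplicativity of \<open>M\<close>, and in the
  case of equality it shows that a combination of two boundary vectors is again on the
  boundary.\<close>

lemma M_decomp:
  "M x y *\<^sub>R (M y z *\<^sub>R z - y) + (M x y *\<^sub>R y - x) = (M x y * M y z) *\<^sub>R z - x"
  by (simp add: algebra_simps)

lemma M_submult:
  assumes "x \<in> K" "y \<in> K" "z \<in> K"
  shows "M x z \<le> M x y * M y z"
proof -
  have "M x y *\<^sub>R (M y z *\<^sub>R z - y) + (M x y *\<^sub>R y - x) \<in> C"
    using assms M_attained M_pos[of x y] by (intro C_add C_scale) auto
  then show ?thesis using M_le_iff[of x z] assms M_decomp by simp
qed

definition D :: "'a \<Rightarrow> 'a \<Rightarrow> real" where "D x y = ln (M x y * M y x)"

lemma D_scale: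
  assumes "x \<in> K" "y \<in> K" "c > 0" "d > 0"
  shows "D (c *\<^sub>R x) (d *\<^sub>R y) = D x y"
  using assms by (simp add: D_def M_scale)

text \<open>The two constants have product 1, so the state inequalities for \<open>x\<close> against
  \<open>y\<close> and for \<open>y\<close> against \<open>x\<close> squeeze to an equality, and
  \<open>M_eq_phi\<close> applies.\<close>

lemma D_zero:
  assumes x: "x \<in> K" and y: "y \<in> K" and "D x y = 0"
  shows "\<exists>c>0. x = c *\<^sub>R y"
proof -
  have p: "\<phi> x > 0" "\<phi> y > 0" "M x y > 0" "M y x > 0" using x y phi_K M_pos by auto
  then have "M x y * M y x = 1" using assms by (simp add: D_def)
  moreover have "\<phi> x \<le> M x y * \<phi> y" "\<phi> y \<le> M y x * \<phi> x" using M_ge_phi x y by auto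
  ultimately have "M x y * \<phi> y \<le> \<phi> x"
    using p mult_left_mono[of "\<phi> y" "M y x * \<phi> x" "M x y"] by (simp add: mult.assoc[symmetric])
  then have "\<phi> x = M x y * \<phi> y" using \<open>\<phi> x \<le> _\<close> by simp
  then show ?thesis using M_eq_phi x y p by (metis K_X)
qed

text \<open>The triangle inequality is the logarithm of a product of two submultiplicative
  inequalities; equality for the product forces equality in each.\<close>

lemma D_add_iff:
  assumes "x \<in> K" "y \<in> K" "z \<in> K"
  shows "D x z = D x y + D y z \<longleftrightarrow> M x z = M x y * M y z \<and> M z x = M z y * M y x"
proof -
  have p: "M x y > 0" "M y x > 0" "M y z > 0" "M z y > 0" "M x z > 0" "M z x > 0"
    using M_pos assms by auto
  have le: "M x z \<le> M x y * M y z" "M z x \<le> M z y * M y x" using M_submult assms by auto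
  have "D x z = D x y + D y z \<longleftrightarrow> M x z * M z x = (M x y * M y x) * (M y z * M z y)"
    using p by (simp add: D_def flip: ln_mult_pos)
  also have "\<dots> \<longleftrightarrow> M x z * M z x = (M x y * M y z) * (M z y * M y x)" by (simp add: ac_simps)
  also have "\<dots> \<longleftrightarrow> M x z = M x y * M y z \<and> M z x = M z y * M y x"
  proof
    assume eq: "M x z * M z x = (M x y * M y z) * (M z y * M y x)"
    then show "M x z = M x y * M y z \<and> M z x = M z y * M y x"
      using p le by (intro mult_eq_imp_eq_of_le) auto
  qed simp
  finally show ?thesis .
qed

text \<open>The ray of \<open>x + y\<close> lies between those of \<open>x\<close> and
  \<open>y\<close>. With \<open>m = M x y\<close> the two factors are \<open>m / (1 + m)\<close> and
  \<open>m + 1\<close>.\<close>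

lemma M_sum:
  assumes x: "x \<in> K" and y: "y \<in> K"
  shows "M x y = M x (x + y) * M (x + y) y"
proof -
  have p: "M x y > 0" using M_pos x y by simp
  have "M (x + y) y = M x y + 1"
  proof (rule M_eqI)
    show "b *\<^sub>R y - (x + y) \<in> C \<longleftrightarrow> M x y + 1 \<le> b" for b
      using M_le_iff[of x y "b - 1"] x y by (simp add: algebra_simps)
  qed (use x y in auto)
  moreover have "M x (x + y) = M x y / (1 + M x y)"
  proof (rule M_eqI)
    fix b
    show "b *\<^sub>R (x + y) - x \<in> C \<longleftrightarrow> M x y / (1 + M x y) \<le> b"
    \<comment> \<open>For \<open>b < 1\<close>, division by \<open>1 - b\<close> turns the condition
      into a bound on \<open>M x y\<close>. For larger \<open>b\<close> both sides hold: the vector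
      is a sum of elements of the cone and the quotient is at most 1.\<close>
    proof (cases "b < 1")
      case True
      have "b *\<^sub>R (x + y) - x = (1 - b) *\<^sub>R ((b / (1 - b)) *\<^sub>R y - x)"
      proof -
        have *: "(1 - b) *\<^sub>R ((b / (1 - b)) *\<^sub>R y - x) = b *\<^sub>R y - (1 - b) *\<^sub>R x"
        proof -
          have "(1 - b) * (b / (1 - b)) = b" using True by simp
          then show ?thesis by (simp only: scaleR_diff_right scaleR_scaleR)
        qed
        show ?thesis unfolding * by (simp add: algebra_simps)
      qed
      then have "b *\<^sub>R (x + y) - x \<in> C \<longleftrightarrow> M x y \<le> b / (1 - b)"
        using True C_scale_iff M_le_iff x y by simp
      then show ?thesis using True p by (simp add: field_simps)
    next
      case False
      then have "(b - 1) *\<^sub>R x + b *\<^sub>R y \<in> C" using x y K_subset_C by (intro C_add C_scale) auto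
      moreover have "M x y / (1 + M x y) \<le> 1" using p by simp
      ultimately show ?thesis using False by (auto simp: algebra_simps)
    qed
  qed (use x y K_add in auto)
  ultimately show ?thesis using p by (simp add: field_simps)
qed

lemma D_sum:
  assumes "x \<in> K" "y \<in> K"
  shows "D x y = D x (x + y) + D (x + y) y"
  using D_add_iff[of x "x + y" y] M_sum[of x y] M_sum[of y x] assms K_add
  by (simp add: add.commute)

section \<open>Planes spanned by two boundary rays\<close>

text \<open>The boundary points \<open>a\<close> and \<open>b\<close> stand for the end-points of a chord of the section. They
  are not normalised by \<open>\<phi>\<close>, so that \<open>a + b\<close> can be made any given interior point.\<close>

definition chord :: "'a \<Rightarrow> 'a \<Rightarrow> bool" where
  "chord a b \<longleftrightarrow> a \<in> C - K \<and> b \<in> C - K \<and> a + b \<in> K"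

lemma chord_sym: "chord a b \<Longrightarrow> chord b a"
  by (simp add: chord_def add.commute)

lemma chord_phi: "chord a b \<Longrightarrow> \<phi> a > 0"
  unfolding chord_def by (metis DiffD1 DiffD2 add_0 phi_pos)

text \<open>If \<open>s < 0\<close>, the state forces \<open>t > 0\<close>. Adding
  \<open>- s\<close> times the interior vector \<open>a + b\<close> then gives
  \<open>(t - s) *\<^sub>R b\<close> in the interior, although \<open>b\<close> is not.\<close>

lemma chord_coeff_nonneg:
  assumes ch: "chord a b" and C: "s *\<^sub>R a + t *\<^sub>R b \<in> C"
  shows "0 \<le> s"
proof (rule ccontr)
  assume s: "\<not> 0 \<le> s"
  have ab: "a \<in> C" "b \<in> C" "a + b \<in> K" "b \<notin> K" using ch by (auto simp: chord_def)
  have "0 \<le> s * \<phi> a + t * \<phi> b" using phi_nonneg[OF C] ab by simp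
  moreover have "s * \<phi> a < 0" using chord_phi[OF ch] s by (simp add: mult_neg_pos)
  ultimately have t: "t > 0" using chord_phi[OF chord_sym[OF ch]] by (smt (verit) mult_nonneg_nonpos mult.commute)
  have "(- s) *\<^sub>R (a + b) + (s *\<^sub>R a + t *\<^sub>R b) \<in> K" 
    using K_add_C[OF K_scale C, of "a + b" "- s"] ab s by simp
  then have "(t - s) *\<^sub>R b \<in> K" by (simp add: algebra_simps)
  then show False using K_scale_iff ab s t by simp
qed

lemma chord_C_iff:
  assumes "chord a b" shows "s *\<^sub>R a + t *\<^sub>R b \<in> C \<longleftrightarrow> 0 \<le> s \<and> 0 \<le> t"
  using chord_coeff_nonneg[OF assms, of s t] chord_coeff_nonneg[OF chord_sym[OF assms], of t s] assms
  by (auto simp: add.commute chord_def intro!: C_add C_scale)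

lemma chord_K_iff:
  assumes ch: "chord a b" shows "s *\<^sub>R a + t *\<^sub>R b \<in> K \<longleftrightarrow> 0 < s \<and> 0 < t"
proof
  assume "s *\<^sub>R a + t *\<^sub>R b \<in> K"
  then obtain e where "e > 0" "s *\<^sub>R a + t *\<^sub>R b - e *\<^sub>R (a + b) \<in> K"
    using K_absorbs ch unfolding chord_def by (meson K_X)
  then have "(s - e) *\<^sub>R a + (t - e) *\<^sub>R b \<in> C" using K_subset_C by (force simp: algebra_simps)
  then show "0 < s \<and> 0 < t" using chord_C_iff[OF ch] \<open>e > 0\<close> by force
next
  assume st: "0 < s \<and> 0 < t"
  \<comment> \<open>The largest multiple of the interior vector \<open>a + b\<close> that can be
    split off with nonnegative coefficients left over.\<close>
  define e where "e = min s t"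
  have "e *\<^sub>R (a + b) + ((s - e) *\<^sub>R a + (t - e) *\<^sub>R b) \<in> K"
    using st ch chord_C_iff[OF ch, of "s - e" "t - e"] K_add_C[OF K_scale, of "a + b" e]
    by (simp add: e_def chord_def)
  then show "s *\<^sub>R a + t *\<^sub>R b \<in> K" by (simp add: algebra_simps)
qed

text \<open>In the coordinates along \<open>a\<close> and \<open>b\<close> the cone is the positive
  quadrant, so domination is tested in each coordinate.\<close>

lemma chord_M:
  assumes ch: "chord a b" and "0 < s" "0 < t" "0 < s'" "0 < t'"
  shows "M (s *\<^sub>R a + t *\<^sub>R b) (s' *\<^sub>R a + t' *\<^sub>R b) = max (s / s') (t / t')"
proof (rule M_eqI)
  fix c
  have "c *\<^sub>R (s' *\<^sub>R a + t' *\<^sub>R b) - (s *\<^sub>R a + t *\<^sub>R b) = (c * s' - s) *\<^sub>R a + (c * t' - t) *\<^sub>R b"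
    by (simp add: algebra_simps)
  moreover have "0 \<le> c * s' - s \<longleftrightarrow> s / s' \<le> c" "0 \<le> c * t' - t \<longleftrightarrow> t / t' \<le> c"
    using assms by (simp_all add: field_simps)
  ultimately show "c *\<^sub>R (s' *\<^sub>R a + t' *\<^sub>R b) - (s *\<^sub>R a + t *\<^sub>R b) \<in> C \<longleftrightarrow> max (s / s') (t / t') \<le> c"
    using chord_C_iff[OF ch, of "c * s' - s" "c * t' - t"] by simp
qed (use chord_K_iff[OF ch] assms in \<open>auto simp: chord_def\<close>)

text \<open>The product of the two maxima is the larger coordinate ratio divided by the smaller.
  Hence the logarithm of \<open>s / t\<close> maps the chord isometrically to the real line.\<close>

lemma chord_D:
  assumes ch: "chord a b" and p: "0 < s" "0 < t" "0 < s'" "0 < t'"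
  shows "D (s *\<^sub>R a + t *\<^sub>R b) (s' *\<^sub>R a + t' *\<^sub>R b) = \<bar>ln (s / t) - ln (s' / t')\<bar>"
proof -
  define \<alpha> \<beta> where "\<alpha> = s / s'" and "\<beta> = t / t'"
  have pos: "\<alpha> > 0" "\<beta> > 0" using p by (auto simp: \<alpha>_def \<beta>_def)
  have "D (s *\<^sub>R a + t *\<^sub>R b) (s' *\<^sub>R a + t' *\<^sub>R b) = ln (max \<alpha> \<beta> * max (1 / \<alpha>) (1 / \<beta>))"
    using chord_M[OF ch] p by (simp add: D_def \<alpha>_def \<beta>_def)
  also have "max \<alpha> \<beta> * max (1 / \<alpha>) (1 / \<beta>) = (if \<alpha> \<le> \<beta> then \<beta> / \<alpha> else \<alpha> / \<beta>)"
    using pos by (simp add: max_def field_simps)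
  also have "ln (if \<alpha> \<le> \<beta> then \<beta> / \<alpha> else \<alpha> / \<beta>) = \<bar>ln \<alpha> - ln \<beta>\<bar>"
    using pos by (auto simp: ln_div)
  also have "ln \<alpha> - ln \<beta> = ln (s / t) - ln (s' / t')"
    using p by (simp add: \<alpha>_def \<beta>_def ln_div)
  finally show ?thesis .
qed

text \<open>\<open>m\<close> and \<open>n\<close> are the least multiples of \<open>x0\<close> that
  push \<open>x\<close> and \<open>- x\<close> into the cone, so both shifted vectors are on the
  boundary. They add up to \<open>(m + n) *\<^sub>R x0\<close>; the state shows
  \<open>m + n > 0\<close> because \<open>x\<close> is not a multiple of \<open>x0\<close>, and
  division by \<open>m + n\<close> makes the sum \<open>x0\<close>.\<close>

lemma chord_exists:
  assumes x0: "x0 \<in> K" and x: "x \<in> X" and ns: "x \<notin> span {x0}"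
  shows "\<exists>a b s t. chord a b \<and> a + b = x0 \<and> x = s *\<^sub>R a + t *\<^sub>R b"
proof -
  define m n where "m = M (- x) x0" and "n = M x x0"
  have a: "m *\<^sub>R x0 + x \<in> C" "m *\<^sub>R x0 + x \<notin> K" and b: "n *\<^sub>R x0 - x \<in> C" "n *\<^sub>R x0 - x \<notin> K"
    using M_attained[of "- x" x0] M_boundary[of "- x" x0] M_attained[of x x0] M_boundary[of x x0] x x0
    by (simp_all add: m_def n_def)
  have "m *\<^sub>R x0 + x \<noteq> 0" using ns span_base[of x0 "{x0}"] span_scale[of x0 "{x0}" "- m"]
    by (metis add.inverse_inverse add_eq_0_iff insertI1 scaleR_minus_left)
  then have "0 < \<phi> (m *\<^sub>R x0 + x)" "0 \<le> \<phi> (n *\<^sub>R x0 - x)" using a b phi_pos phi_nonneg by auto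
  then have "0 < (m + n) * \<phi> x0" using x x0 by (simp add: algebra_simps)
  then have mn: "m + n > 0" using phi_K[OF x0] by (simp add: zero_less_mult_iff)
  define a' b' where "a' = (1 / (m + n)) *\<^sub>R (m *\<^sub>R x0 + x)" and "b' = (1 / (m + n)) *\<^sub>R (n *\<^sub>R x0 - x)"
  have sum: "a' + b' = x0"
  proof -
    have "a' + b' = (1 / (m + n)) *\<^sub>R ((m + n) *\<^sub>R x0)"
      unfolding a'_def b'_def scaleR_add_right[symmetric] by (simp add: scaleR_left.add)
    then show ?thesis using mn by simp
  qed
  have "chord a' b'"
    unfolding chord_def sum using a b x0 mn by (simp add: a'_def b'_def C_scale_iff K_scale_iff)
  moreover have "x = n *\<^sub>R a' + (- m) *\<^sub>R b'"
  proof -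
    have "(m + n) *\<^sub>R a' = m *\<^sub>R x0 + x" using mn by (simp add: a'_def)
    then have "x = (m + n) *\<^sub>R a' - m *\<^sub>R x0" by simp
    also have "\<dots> = (m + n) *\<^sub>R a' - m *\<^sub>R (a' + b')" by (simp only: sum)
    also have "\<dots> = n *\<^sub>R a' + (- m) *\<^sub>R b'" by (simp add: algebra_simps)
    finally show ?thesis .
  qed
  ultimately show ?thesis using sum by blast
qed

section \<open>Strict convexity and equality in the triangle inequality\<close>

lemma boundary_point:
  assumes a: "a \<in> C" "a \<notin> K" "\<phi> a = 1"
  shows "a \<in> section_boundary X C u \<phi>"
proof -
  interpret Metric_space X "order_unit_dist X C u" by (rule order_unit_metric[OF ous])
  define H where "H = {x \<in> X. \<phi> x = 1}"
  define S where "S = state_section X C u \<phi>"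
  have SH: "S \<subseteq> H" by (auto simp: S_def H_def state_section_def)
  have "a \<in> mtopology closure_of S"
  proof -
    have "\<exists>y\<in>S. y \<in> mball a r" if r: "r > 0" for r
    proof -
      obtain l m where l: "l > 0" "l *\<^sub>R u - (a - u) \<in> C" and m: "m > 0" "m *\<^sub>R u - (u - a) \<in> C"
        using order_unit_bound[of "a - u"] order_unit_bound[of "u - a"] a u_in_C by auto
      \<comment> \<open>\<open>l\<close> and \<open>m\<close> bound \<open>a - u\<close> from either
        side, so \<open>l + m\<close> bounds both sides at once; the minimum with 1 keeps
        \<open>w\<close> on the segment from \<open>a\<close> to \<open>u\<close>, whose points
        other than \<open>a\<close> are interior.\<close>
      define t where "t = min 1 (r / (2 * (l + m)))"
      have t: "0 < t" "t \<le> 1" "t * (l + m) < r"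
        using r l m min.cobounded2[of 1 "r / (2 * (l + m))"]
      by (auto simp: t_def field_simps simp del: min.cobounded2 min.bounded_iff)
      define w where "w = (1 - t) *\<^sub>R a + t *\<^sub>R u"
      have "w \<in> K" using t a K_add_C[OF K_scale[OF u_in_K] C_scale[OF a(1)], of t "1 - t"]
        by (simp add: w_def add.commute)
      then have "w \<in> S" using a u_in_C by (simp add: S_def state_section_def w_def)
      moreover have "order_unit_dist X C u a w < r"
      proof (rule order_unit_dist_less)
        have aw: "a - w = t *\<^sub>R (a - u)" by (simp add: w_def algebra_simps)
        have "(t * (l + m)) *\<^sub>R u + (a - w) = t *\<^sub>R ((m *\<^sub>R u - (u - a)) + l *\<^sub>R u)"
          unfolding aw by (simp add: algebra_simps)
        then show "(t * (l + m)) *\<^sub>R u + (a - w) \<in> C"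
          using t l m u_in_C by (simp add: C_scale C_add)
        have "(t * (l + m)) *\<^sub>R u - (a - w) = t *\<^sub>R ((l *\<^sub>R u - (a - u)) + m *\<^sub>R u)"
          unfolding aw by (simp add: algebra_simps)
        then show "(t * (l + m)) *\<^sub>R u - (a - w) \<in> C"
          using t l m u_in_C by (simp add: C_scale C_add)
      qed (use a t l m \<open>w \<in> K\<close> in auto)
      ultimately show ?thesis using \<open>w \<in> K\<close> a by (intro bexI[of _ w]) (auto simp: in_mball)
    qed
    then show ?thesis using a by (simp add: metric_closure_of)
  qed
  then have "a \<in> subtopology mtopology H closure_of S"
    using a SH by (simp add: closure_of_subtopology H_def Int_absorb1)
  moreover have "a \<notin> subtopology mtopology H interior_of S"
    using interior_of_subset[of "subtopology mtopology H" S] a by (auto simp: S_def state_section_def)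
  ultimately show ?thesis
    by (simp add: section_boundary_def frontier_of_def order_unit_topology_def H_def S_def)
qed

text \<open>Strict convexity rephrased for rays: if the points of state 1 on the two rays differed,
  the open segment between them would be interior, and it meets the ray of
  \<open>a + b\<close>.\<close>

lemma strict_convex_ray:
  assumes sc: "strictly_convex_section X C u \<phi>"
    and a: "a \<in> C" "a \<notin> K" "a \<noteq> 0" and b: "b \<in> C" "b \<notin> K" "b \<noteq> 0" and ab: "a + b \<notin> K"
  shows "\<exists>c>0. a = c *\<^sub>R b"
proof -
  have p: "\<phi> a > 0" "\<phi> b > 0" using a b phi_pos by auto
  define a' b' where "a' = (1 / \<phi> a) *\<^sub>R a" and "b' = (1 / \<phi> b) *\<^sub>R b"
  have bd: "a' \<in> section_boundary X C u \<phi>" "b' \<in> section_boundary X C u \<phi>"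
    using a b p by (auto intro!: boundary_point simp: a'_def b'_def C_scale_iff K_scale_iff)
  have "a' = b'"
  proof (rule ccontr)
    assume ne: "a' \<noteq> b'"
    \<comment> \<open>The weight for which the convex combination of \<open>a'\<close> and
      \<open>b'\<close> is a multiple of \<open>a + b\<close>.\<close>
    define t where "t = \<phi> b / (\<phi> a + \<phi> b)"
    have t: "0 < t" "t < 1" "1 - t = \<phi> a / (\<phi> a + \<phi> b)" using p by (auto simp: t_def field_simps)
    have "(1 - t) *\<^sub>R a' + t *\<^sub>R b' \<in> open_segment a' b'" using t ne by (auto simp: in_segment)
    then have "(1 - t) *\<^sub>R a' + t *\<^sub>R b' \<in> K"
      using sc bd ne by (auto simp: strictly_convex_section_def state_section_def)
    moreover have "(1 - t) *\<^sub>R a' + t *\<^sub>R b' = (1 / (\<phi> a + \<phi> b)) *\<^sub>R (a + b)"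
      unfolding t(3) using p by (simp add: t_def a'_def b'_def algebra_simps)
    ultimately show False using ab p K_scale_iff[of "1 / (\<phi> a + \<phi> b)" "a + b"] by simp
  qed
  then have "a = (\<phi> a / \<phi> b) *\<^sub>R b" using p unfolding a'_def b'_def
    by (metis divide_inverse inverse_eq_divide less_numeral_extra(3) right_inverse scaleR_one scaleR_scaleR)
  then show ?thesis using p by (intro exI[of _ "\<phi> a / \<phi> b"]) auto
qed

text \<open>Additivity puts \<open>p\<close>, \<open>q\<close> and \<open>m *\<^sub>R p + q\<close>
  all on the boundary. So \<open>p\<close> or \<open>q\<close> vanishes or they are parallel, and
  each case is a linear relation in which \<open>y\<close> has a nonzero coefficient.\<close>

lemma D_add_imp_span:
  assumes sc: "strictly_convex_section X C u \<phi>"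
    and xyz: "x \<in> K" "y \<in> K" "z \<in> K" and D: "D x z = D x y + D y z"
  shows "y \<in> span {x, z}"
proof -
  define m n where "m = M x y" and "n = M y z"
  have pos: "m > 0" "n > 0" using M_pos xyz by (auto simp: m_def n_def)
  define p q where "p = n *\<^sub>R z - y" and "q = m *\<^sub>R y - x"
  have "M x z = m * n" using D_add_iff[OF xyz] D by (simp add: m_def n_def)
  then have nK: "m *\<^sub>R p + q \<notin> K"
  proof -
    have "m *\<^sub>R p + q = M x z *\<^sub>R z - x"
      using M_decomp[of x y z] \<open>M x z = m * n\<close> by (simp only: m_def n_def p_def q_def)
    then show ?thesis using M_boundary[of x z] xyz by simp
  qed
  have pC: "p \<in> C" "p \<notin> K" "q \<in> C" "q \<notin> K"
    using M_attained M_boundary xyz by (auto simp: m_def n_def p_def q_def)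
  have sp: "x \<in> span {x, z}" "z \<in> span {x, z}" by (auto intro: span_base)
  consider "p = 0" | "q = 0" | c where "c > 0" "m *\<^sub>R p = c *\<^sub>R q"
    using strict_convex_ray[OF sc, of "m *\<^sub>R p" q] pC pos nK
    by (auto simp: C_scale_iff K_scale_iff)
  then show ?thesis
  proof cases
    case 1
    then have "y = n *\<^sub>R z" by (simp add: p_def)
    then show ?thesis using sp by (simp add: span_scale)
  next
    case 2
    then have "y = (1 / m) *\<^sub>R x" using pos by (auto simp: q_def)
    then show ?thesis using sp by (simp add: span_scale)
  next
    case (3 c)
    have "(m + c * m) *\<^sub>R y = (m * n) *\<^sub>R z + c *\<^sub>R x"
      using 3(2) by (simp add: p_def q_def algebra_simps)
    moreover have "m + c * m > 0" using 3 pos by (simp add: pos_add_strict)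
    ultimately have "y = (1 / (m + c * m)) *\<^sub>R ((m * n) *\<^sub>R z + c *\<^sub>R x)"
      by (metis less_irrefl nonzero_divide_eq_eq scaleR_one scaleR_scaleR)
    then show ?thesis using sp by (simp add: span_scale span_add)
  qed
qed

end

section \<open>Hilbert's metric of a convex set as \<open>D\<close> on the section\<close>

text \<open>\<open>g\<close> is known to respect convex combinations inside \<open>A\<close> only.
  For a point beyond \<open>y\<close>, write \<open>y\<close> as a convex combination of
  \<open>x\<close> and that point; the converse takes a preimage and uses injectivity. Points beyond
  \<open>x\<close> follow by exchanging the roles.\<close>

lemma affine_isomorphism_line:
  assumes iso: "affine_isomorphism A B g" and cv: "convex A"
    and x: "x \<in> A" and y: "y \<in> A" and ne: "x \<noteq> y"
  shows "x + t *\<^sub>R (y - x) \<in> A \<longleftrightarrow> g x + t *\<^sub>R (g y - g x) \<in> B"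
proof -
  have bij: "bij_betw g A B" using iso by (simp add: affine_isomorphism_def)
  then have gB: "g a \<in> B" if "a \<in> A" for a using that bij_betwE by metis
  have conv_comb: "g (a + s *\<^sub>R (b - a)) = g a + s *\<^sub>R (g b - g a)"
    if "a \<in> A" "b \<in> A" "0 \<le> s" "s \<le> 1" for a b s
  proof -
    have "a + s *\<^sub>R (b - a) = (1 - s) *\<^sub>R a + s *\<^sub>R b" by (simp add: algebra_simps)
    then have "g (a + s *\<^sub>R (b - a)) = (1 - s) *\<^sub>R g a + s *\<^sub>R g b"
      using iso that by (auto simp: affine_isomorphism_def)
    then show ?thesis by (simp add: algebra_simps)
  qed
  have mem: "a + s *\<^sub>R (b - a) \<in> A" if "a \<in> A" "b \<in> A" "0 \<le> s" "s \<le> 1" for a b s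
  proof -
    have "(1 - s) *\<^sub>R a + s *\<^sub>R b \<in> A" using convexD_alt[OF cv] that by blast
    then show ?thesis by (simp add: algebra_simps)
  qed
  have beyond: "a + s *\<^sub>R (b - a) \<in> A \<longleftrightarrow> g a + s *\<^sub>R (g b - g a) \<in> B"
    if ab: "a \<in> A" "b \<in> A" and s: "s > 1" for a b s
  proof
    assume p: "a + s *\<^sub>R (b - a) \<in> A"
    have "a + (1/s) *\<^sub>R ((a + s *\<^sub>R (b - a)) - a) = b" using s by simp
    then have "g b = g a + (1/s) *\<^sub>R (g (a + s *\<^sub>R (b - a)) - g a)"
      using conv_comb[OF ab(1) p, of "1/s"] s by simp
    then have "g (a + s *\<^sub>R (b - a)) = g a + s *\<^sub>R (g b - g a)" using s by simp
    then show "g a + s *\<^sub>R (g b - g a) \<in> B" using gB[OF p] by simp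
  next
    assume "g a + s *\<^sub>R (g b - g a) \<in> B"
    then obtain p where p: "p \<in> A" "g p = g a + s *\<^sub>R (g b - g a)"
      using bij by (metis bij_betw_iff_bijections)
    have "g (a + (1/s) *\<^sub>R (p - a)) = g b"
      using conv_comb[OF ab(1) p(1), of "1/s"] s p(2) by simp
    then have "a + (1/s) *\<^sub>R (p - a) = b"
      using bij mem[OF ab(1) p(1), of "1/s"] s ab(2) by (auto simp: bij_betw_def dest: inj_onD)
    then have "p = a + s *\<^sub>R (b - a)" using s by auto
    then show "a + s *\<^sub>R (b - a) \<in> A" using p by simp
  qed
  consider "t > 1" | "0 \<le> t" "t \<le> 1" | "t < 0" by linarith
  then show ?thesis
  proof cases
    case 1
    then show ?thesis using beyond[OF x y] by simp
  next
    case 2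
    then show ?thesis using mem[OF x y] conv_comb[OF x y] gB by metis
  next
    case 3
    have "x + t *\<^sub>R (y - x) = y + (1 - t) *\<^sub>R (x - y)"
      "g x + t *\<^sub>R (g y - g x) = g y + (1 - t) *\<^sub>R (g x - g y)"
      by (simp_all add: algebra_simps)
    then show ?thesis using beyond[OF y x, of "1 - t"] 3 by simp
  qed
qed

text \<open>In the parameter \<open>t\<close>, with \<open>x\<close> at 0 and \<open>y\<close> at 1,
  the chord is a real interval; \<open>p\<close> and \<open>q\<close> are its lengths beyond
  \<open>x\<close> and beyond \<open>y\<close>. The work lies in the uniqueness behind
  \<open>chord_ends\<close>.\<close>

lemma hilbert_metric_chord:
  fixes x y :: "'a::real_vector"
  assumes ne: "x \<noteq> y" and p: "0 < p" and q: "0 < q"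
    and mem: "\<And>t. x + t *\<^sub>R (y - x) \<in> \<Omega> \<longleftrightarrow> - p < t \<and> t < 1 + q"
  shows "hilbert_metric \<Omega> x y = ln ((1 + p) / p * ((1 + q) / q))"
proof -
  define e where "e t = x + t *\<^sub>R (y - x)" for t
  have e_diff: "e b - e a = (b - a) *\<^sub>R (y - x)" for a b by (simp add: e_def algebra_simps)
  have inj: "inj e" using ne by (auto simp: inj_on_def e_def)
  have e01: "e 0 = x" "e 1 = y" by (simp_all add: e_def)
  have hull: "affine hull {x, y} = range e"
  proof
    show "affine hull {x, y} \<subseteq> range e"
    proof
      fix z assume "z \<in> affine hull {x, y}"
      then obtain a b where "z = a *\<^sub>R x + b *\<^sub>R y" "a + b = 1" by (auto simp: affine_hull_2)
      moreover from this have "a = 1 - b" by simp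
      ultimately have "z = e b" by (simp add: e_def algebra_simps)
      then show "z \<in> range e" by simp
    qed
    show "range e \<subseteq> affine hull {x, y}"
    proof
      fix z assume "z \<in> range e"
      then obtain t where "z = e t" by blast
      then have "z = (1 - t) *\<^sub>R x + t *\<^sub>R y" by (simp add: e_def algebra_simps)
      moreover have "(1 - t) + t = 1" by simp
      ultimately show "z \<in> affine hull {x, y}" unfolding affine_hull_2 by blast
    qed
  qed
  have e_comb: "(1 - s) *\<^sub>R e a + s *\<^sub>R e b = e ((1 - s) *\<^sub>R a + s *\<^sub>R b)" for a b s
    by (simp add: e_def algebra_simps)
  have e_eq: "e a = e b \<longleftrightarrow> a = b" for a b using inj by (auto dest: injD)
  have seg: "open_segment (e a) (e b) = e ` open_segment a b" for a b
    unfolding set_eq_iff image_iff in_segment Bex_def e_comb e_eq by blast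
  have cseg: "closed_segment (e a) (e b) = e ` closed_segment a b" for a b
    unfolding set_eq_iff image_iff in_segment Bex_def e_comb by blast
  have between_e: "between (e a, e b) (e c) \<longleftrightarrow> c \<in> closed_segment a b" for a b c
    using inj by (simp add: between_mem_segment cseg inj_image_mem_iff)
  have trace: "\<Omega> \<inter> affine hull {x, y} = e ` {- p<..<1 + q}"
  proof -
    have "e t \<in> \<Omega> \<longleftrightarrow> t \<in> {- p<..<1 + q}" for t using mem[of t] by (simp add: e_def)
    then show ?thesis unfolding hull by blast
  qed
  have ends: "chord_ends \<Omega> x y = (e (- p), e (1 + q))"
    unfolding chord_ends_def
  proof (rule the_equality, clarsimp, intro conjI)
    show "\<Omega> \<inter> affine hull {x, y} = open_segment (e (- p)) (e (1 + q))"
      using p q by (simp add: trace seg open_segment_eq_real_ivl)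
    show "between (e (- p), y) x" "between (e (1 + q), x) y"
      using between_e[of "- p" 1 0] between_e[of "1 + q" 0 1] p q
      by (simp_all add: e01 closed_segment_eq_real_ivl)
  next
    fix w assume "case w of (x', y') \<Rightarrow> \<Omega> \<inter> affine hull {x, y} = open_segment x' y' \<and>
        between (x', y) x \<and> between (y', x) y"
    then obtain x' y' where w: "w = (x', y')" and os: "open_segment x' y' = e ` {- p<..<1 + q}"
      and btw: "between (x', y) x"
      by (cases w) (auto simp: trace)
    \<comment> \<open>The candidate end-points are not assumed to lie on the line; they do because
      the distinct points \<open>x\<close> and \<open>y\<close> lie on the segment between
      them.\<close>
    have "x \<in> open_segment x' y'" "y \<in> open_segment x' y'"
      unfolding os using p q by (metis e01 imageI greaterThanLessThan_iff add_pos_pos neg_less_0_iff_less zero_less_one,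
       metis e01 imageI greaterThanLessThan_iff less_add_same_cancel1 less_trans neg_less_0_iff_less zero_less_one)
    then obtain s s' where s: "x = (1 - s) *\<^sub>R x' + s *\<^sub>R y'" "y = (1 - s') *\<^sub>R x' + s' *\<^sub>R y'"
      by (auto simp: in_segment)
    have yx: "y - x = (s' - s) *\<^sub>R (y' - x')" unfolding s by (simp add: algebra_simps)
    then have "s' \<noteq> s" using ne by auto
    then have k: "y' - x' = (1 / (s' - s)) *\<^sub>R (y - x)" using yx by simp
    have "x' = x - s *\<^sub>R (y' - x')" "y' = x + (1 - s) *\<^sub>R (y' - x')"
      unfolding s(1) by (simp_all add: algebra_simps)
    then obtain a b where ab: "x' = e a" "y' = e b"
      unfolding k e_def by (metis scaleR_scaleR scaleR_minus_left diff_conv_add_uminus)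
    have iv: "open_segment a b = {- p<..<1 + q}"
      using os inj unfolding ab seg by (simp add: inj_image_eq_iff)
    have ioo: "c = - p \<and> d = 1 + q" if "{c<..<d} = {- p<..<1 + q}" for c d
    proof -
      have "{c<..<d} \<subseteq> {- p<..<1 + q}" "{- p<..<1 + q} \<subseteq> {c<..<d}" using that by auto
      then show ?thesis using p q unfolding greaterThanLessThan_subseteq_greaterThanLessThan by auto
    qed
    \<comment> \<open>An open segment does not know the order of its ends; the
      \<open>between\<close> condition excludes the reversed pair.\<close>
    have "a \<le> b"
    proof (rule ccontr)
      assume "\<not> a \<le> b"
      then have "a = 1 + q" using iv ioo[of b a] by (simp add: open_segment_eq_real_ivl)
      then show False using btw between_e[of a 1 0] q by (simp add: ab e01 closed_segment_eq_real_ivl)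
    qed
    then have "a = - p \<and> b = 1 + q" using iv ioo[of a b] by (simp add: open_segment_eq_real_ivl)
    then show "w = (e (- p), e (1 + q))" using w ab by simp
  qed
  have len: "line_length x y (e a) (e b) = \<bar>b - a\<bar>" for a b
    unfolding line_length_def e_diff using ne by (intro the_equality) auto
  have "line_length x y (e (- p)) y = 1 + p" "line_length x y (e (- p)) x = p"
    "line_length x y (e (1 + q)) x = 1 + q" "line_length x y (e (1 + q)) y = q"
    using len[of "- p" 1] len[of "- p" 0] len[of "1 + q" 0] len[of "1 + q" 1] p q by (simp_all add: e01)
  then show ?thesis using ne by (simp add: hilbert_metric_def ends Let_def)
qed

context state_space
begin

lemma M_self: "x \<in> K \<Longrightarrow> M x x = 1"
proof (rule M_eqI)
  fix b assume x: "x \<in> K"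
  have "b *\<^sub>R x - x = (b - 1) *\<^sub>R x" by (simp add: algebra_simps)
  moreover have "0 \<le> b - 1" if "(b - 1) *\<^sub>R x \<in> C"
    using phi_nonneg[OF that] phi_K[OF x] x by (simp add: zero_le_mult_iff)
  ultimately show "b *\<^sub>R x - x \<in> C \<longleftrightarrow> 1 \<le> b"
    using C_scale[OF K_subset_C[OF x], of "b - 1"] by auto
qed auto

lemma D_self: "x \<in> K \<Longrightarrow> D x x = 0"
  by (simp add: D_def M_self)

lemma scale_K_in_C_iff:
  assumes "x \<in> K" shows "c *\<^sub>R x \<in> C \<longleftrightarrow> 0 \<le> c"
  using phi_nonneg[of "c *\<^sub>R x"] phi_K[OF assms] C_scale[OF K_subset_C] assms
  by (auto simp: zero_le_mult_iff)

lemma scale_K_in_K_iff: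
  assumes "x \<in> K" shows "c *\<^sub>R x \<in> K \<longleftrightarrow> 0 < c"
  using phi_K[of "c *\<^sub>R x"] phi_K[OF assms] K_scale assms by (auto simp: zero_less_mult_iff)

text \<open>Beyond \<open>w\<close>, the point \<open>v + t *\<^sub>R (w - v)\<close> is
  \<open>t - 1\<close> times \<open>(t / (t - 1)) *\<^sub>R w - v\<close>, so the chord ends where
  \<open>t / (t - 1) = M v w\<close>. The other end is symmetric, and the two factors of the
  cross-ratio become \<open>\<nu>\<close> and \<open>\<mu>\<close>.\<close>

lemma hilbert_metric_eq_D:
  assumes iso: "affine_isomorphism \<Omega> (state_section X C u \<phi>) g" and cv: "convex \<Omega>"
    and x: "x \<in> \<Omega>" and y: "y \<in> \<Omega>"
  shows "hilbert_metric \<Omega> x y = D (g x) (g y)"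
proof (cases "x = y")
  case True
  have "g x \<in> K"
    using iso x by (auto simp: affine_isomorphism_def state_section_def dest!: bij_betwE)
  then show ?thesis using True by (simp add: hilbert_metric_def D_self)
next
  case False
  define v w where "v = g x" and "w = g y"
  have vw: "v \<in> K" "w \<in> K" "\<phi> v = 1" "\<phi> w = 1"
    using iso x y by (auto simp: affine_isomorphism_def state_section_def v_def w_def dest!: bij_betwE)
  have "v \<noteq> w"
    using iso x y False by (auto simp: affine_isomorphism_def v_def w_def bij_betw_def dest: inj_onD)
  define \<mu> \<nu> where "\<mu> = M v w" and "\<nu> = M w v"
  have "\<mu> \<ge> 1" "\<nu> \<ge> 1" using M_ge_phi[of v w] M_ge_phi[of w v] vw by (auto simp: \<mu>_def \<nu>_def)
  moreover have "\<mu> \<noteq> 1" "\<nu> \<noteq> 1"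
    using M_eq_phi[of v w] M_eq_phi[of w v] vw \<open>v \<noteq> w\<close> by (auto simp: \<mu>_def \<nu>_def)
  ultimately have gt: "\<mu> > 1" "\<nu> > 1" by auto
  have line: "v + t *\<^sub>R (w - v) \<in> K \<longleftrightarrow> - (1 / (\<nu> - 1)) < t \<and> t < 1 + 1 / (\<mu> - 1)" for t
  proof -
    consider "t > 1" | "0 \<le> t" "t \<le> 1" | "t < 0" by linarith
    then show ?thesis
    proof cases
      case 1
      have "(t - 1) *\<^sub>R ((t / (t - 1)) *\<^sub>R w - v) = ((t - 1) * (t / (t - 1))) *\<^sub>R w - (t - 1) *\<^sub>R v"
        by (simp only: scaleR_diff_right scaleR_scaleR)
      also have "(t - 1) * (t / (t - 1)) = t" using 1 by simp
      also have "t *\<^sub>R w - (t - 1) *\<^sub>R v = v + t *\<^sub>R (w - v)" by (simp add: algebra_simps)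
      finally have "v + t *\<^sub>R (w - v) \<in> K \<longleftrightarrow> \<mu> < t / (t - 1)"
        using K_scale_iff[of "t - 1" "(t / (t - 1)) *\<^sub>R w - v"] M_less_iff vw 1 by (simp add: \<mu>_def)
      also have "\<dots> \<longleftrightarrow> t < 1 + 1 / (\<mu> - 1)" using 1 gt by (simp add: field_simps)
      finally show ?thesis using 1 gt by (smt (verit) divide_pos_pos)
    next
      case 2
      have "(1 - t) *\<^sub>R v + t *\<^sub>R w \<in> K"
      proof (cases "t = 0")
        case False
        then show ?thesis using 2 K_add_C[OF K_scale[of w t] C_scale[of v "1 - t"]] vw K_subset_C
          by (simp add: add.commute)
      qed (use vw in simp)
      then have "v + t *\<^sub>R (w - v) \<in> K" by (simp add: algebra_simps)
      then show ?thesis using 2 gt by (smt (verit) divide_pos_pos)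
    next
      case 3
      have "(- t) *\<^sub>R (((1 - t) / (- t)) *\<^sub>R v - w) = (- t * ((1 - t) / (- t))) *\<^sub>R v - (- t) *\<^sub>R w"
        by (simp only: scaleR_diff_right scaleR_scaleR)
      also have "- t * ((1 - t) / (- t)) = 1 - t" using 3 by simp
      also have "(1 - t) *\<^sub>R v - (- t) *\<^sub>R w = v + t *\<^sub>R (w - v)" by (simp add: algebra_simps)
      finally have "v + t *\<^sub>R (w - v) \<in> K \<longleftrightarrow> \<nu> < (1 - t) / (- t)"
        using K_scale_iff[of "- t" "((1 - t) / (- t)) *\<^sub>R v - w"] M_less_iff vw 3 by (simp add: \<nu>_def)
      also have "\<dots> \<longleftrightarrow> - (1 / (\<nu> - 1)) < t" using 3 gt by (simp add: field_simps)
      finally show ?thesis using 3 gt by (smt (verit) divide_pos_pos)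
    qed
  qed
  have "x + t *\<^sub>R (y - x) \<in> \<Omega> \<longleftrightarrow> - (1 / (\<nu> - 1)) < t \<and> t < 1 + 1 / (\<mu> - 1)" for t
  proof -
    have "\<phi> (v + t *\<^sub>R (w - v)) = 1" using vw by simp
    then show ?thesis
      using affine_isomorphism_line[OF iso cv x y False, of t] line[of t]
      by (simp add: state_section_def v_def w_def)
  qed
  then have "hilbert_metric \<Omega> x y =
      ln ((1 + 1 / (\<nu> - 1)) / (1 / (\<nu> - 1)) * ((1 + 1 / (\<mu> - 1)) / (1 / (\<mu> - 1))))"
    using gt False by (intro hilbert_metric_chord) auto
  also have "(1 + 1 / (\<nu> - 1)) / (1 / (\<nu> - 1)) = \<nu>" using gt by (simp add: field_simps)
  also have "(1 + 1 / (\<mu> - 1)) / (1 / (\<mu> - 1)) = \<mu>" using gt by (simp add: field_simps)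
  finally show ?thesis by (simp add: D_def \<mu>_def \<nu>_def v_def w_def mult.commute)
qed

end

section \<open>The isometry as a map on rays of the open cones\<close>

locale hilbert_embedding =
  S1: state_space X\<^sub>1 C\<^sub>1 u\<^sub>1 \<phi>\<^sub>1 + S2: state_space X\<^sub>2 C\<^sub>2 u\<^sub>2 \<phi>\<^sub>2
  for X\<^sub>1 C\<^sub>1 :: "'a::real_vector set" and u\<^sub>1 \<phi>\<^sub>1
    and X\<^sub>2 C\<^sub>2 :: "'b::real_vector set" and u\<^sub>2 \<phi>\<^sub>2 +
  fixes G :: "'a \<Rightarrow> 'b"
  assumes G_in: "x \<in> S1.K \<Longrightarrow> G x \<in> S2.K"
    and G_isometric: "x \<in> S1.K \<Longrightarrow> y \<in> S1.K \<Longrightarrow> S2.D (G x) (G y) = S1.D x y"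
    and strict: "strictly_convex_section X\<^sub>2 C\<^sub>2 u\<^sub>2 \<phi>\<^sub>2"
begin

text \<open>Strict convexity of the target enters here. Linear relations between values of
  \<open>G\<close> on different rays come from this lemma.\<close>

lemma G_D_add_span:
  assumes "x \<in> S1.K" "y \<in> S1.K" "z \<in> S1.K" "S1.D x z = S1.D x y + S1.D y z"
  shows "G y \<in> span {G x, G z}"
  using S2.D_add_imp_span[OF strict, of "G x" "G y" "G z"] assms G_in G_isometric by simp

lemma G_scale:
  assumes "x \<in> S1.K" "c > 0" shows "\<exists>d>0. G (c *\<^sub>R x) = d *\<^sub>R G x"
  using S2.D_zero[of "G (c *\<^sub>R x)" "G x"] assms G_in G_isometric S1.K_scale
    S1.D_scale[of x x c 1] S1.D_self by simp

lemma G_proportional: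
  assumes x: "x \<in> S1.K" and y: "y \<in> S1.K" and "c > 0" "G x = c *\<^sub>R G y"
  shows "\<exists>d>0. x = d *\<^sub>R y"
proof (rule S1.D_zero[OF x y])
  show "S1.D x y = 0"
    using S2.D_scale[of "G y" "G y" c 1] G_isometric[OF x y] assms G_in S2.D_self by simp
qed

definition y\<^sub>0 where "y\<^sub>0 = G u\<^sub>1"

lemma y0_in_K: "y\<^sub>0 \<in> S2.K"
  by (simp add: y\<^sub>0_def G_in S1.u_in_K)

text \<open>A reference point \<open>p\<close> on the source chord fixes the target plane and the
  orientation of the target chord. The image of any \<open>q\<close> lies in that plane, because one
  of \<open>q\<close>, \<open>u\<^sub>1\<close>, \<open>p\<close> is metrically between the other
  two; its distances to the images of \<open>u\<^sub>1\<close> and \<open>p\<close> then fix its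
  coordinate ratio.\<close>

lemma G_chord:
  assumes x: "x \<in> X\<^sub>1" and ns: "x \<notin> span {u\<^sub>1}"
  obtains a b a' b' s t where "S1.chord a b" "a + b = u\<^sub>1" "S2.chord a' b'" "a' + b' = y\<^sub>0"
    "x = s *\<^sub>R a + t *\<^sub>R b"
    "\<And>A B. 0 < A \<Longrightarrow> 0 < B \<Longrightarrow> \<exists>c>0. A *\<^sub>R a' + B *\<^sub>R b' = c *\<^sub>R G (A *\<^sub>R a + B *\<^sub>R b)"
proof -
  obtain a b s t where ch: "S1.chord a b" and sum: "a + b = u\<^sub>1" and xst: "x = s *\<^sub>R a + t *\<^sub>R b"
    using S1.chord_exists[OF S1.u_in_K x ns] by blast
  \<comment> \<open>Any ratio other than 1 would put \<open>p\<close> off the ray of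
    \<open>u\<^sub>1\<close>; with 2 the distance is \<open>ln 2\<close>.\<close>
  define p where "p = 2 *\<^sub>R a + 1 *\<^sub>R b"
  have pK: "p \<in> S1.K" unfolding p_def S1.chord_K_iff[OF ch] by simp
  have u: "u\<^sub>1 = 1 *\<^sub>R a + 1 *\<^sub>R b" using sum by simp
  have Dp: "S1.D p u\<^sub>1 = ln 2" unfolding u p_def using S1.chord_D[OF ch, of 2 1 1 1] by simp
  have GpK: "G p \<in> S2.K" using G_in pK by simp
  have Gp: "G p \<notin> span {y\<^sub>0}"
  proof
    assume "G p \<in> span {y\<^sub>0}"
    then obtain c where c: "G p = c *\<^sub>R y\<^sub>0" by (auto simp: span_singleton)
    then have "c > 0" using GpK S2.scale_K_in_K_iff[OF y0_in_K] by simp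
    then have "S2.D (G p) (G u\<^sub>1) = 0"
      using S2.D_scale[OF y0_in_K y0_in_K, of c 1] S2.D_self[OF y0_in_K] c by (simp add: y\<^sub>0_def)
    then show False using Dp G_isometric[OF pK S1.u_in_K] by simp
  qed
  have "\<exists>a' b' \<alpha> \<beta>. S2.chord a' b' \<and> a' + b' = y\<^sub>0 \<and> G p = \<alpha> *\<^sub>R a' + \<beta> *\<^sub>R b' \<and> 0 < \<alpha> \<and> 0 < \<beta>
      \<and> ln (\<alpha> / \<beta>) = ln 2"
  proof -
    obtain a' b' \<alpha> \<beta> where ch': "S2.chord a' b'" and sum': "a' + b' = y\<^sub>0"
      and G: "G p = \<alpha> *\<^sub>R a' + \<beta> *\<^sub>R b'"
      using S2.chord_exists[OF y0_in_K _ Gp] GpK by auto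
    have pos: "0 < \<alpha>" "0 < \<beta>" using GpK S2.chord_K_iff[OF ch'] G by auto
    have "S2.D (G p) (1 *\<^sub>R a' + 1 *\<^sub>R b') = \<bar>ln (\<alpha> / \<beta>)\<bar>"
      unfolding G using S2.chord_D[OF ch' pos, of 1 1] by simp
    then have "\<bar>ln (\<alpha> / \<beta>)\<bar> = ln 2"
      using G_isometric[OF pK S1.u_in_K] Dp sum' by (simp add: y\<^sub>0_def)
    \<comment> \<open>The distance to \<open>y\<^sub>0\<close> gives the logarithm up to sign; if
      the sign is wrong, \<open>a'\<close> and \<open>b'\<close> are exchanged.\<close>
    then consider "ln (\<alpha> / \<beta>) = ln 2" | "ln (\<beta> / \<alpha>) = ln 2"
      using pos by (auto simp: ln_div abs_if split: if_splits)
    then show ?thesis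
    proof cases
      case 1
      then show ?thesis using ch' sum' G pos by blast
    next
      case 2
      then show ?thesis using S2.chord_sym[OF ch'] sum' G pos by (metis add.commute)
    qed
  qed
  then obtain a' b' \<alpha> \<beta> where ch': "S2.chord a' b'" and sum': "a' + b' = y\<^sub>0"
    and G: "G p = \<alpha> *\<^sub>R a' + \<beta> *\<^sub>R b'" and pos: "0 < \<alpha>" "0 < \<beta>" and ratio: "ln (\<alpha> / \<beta>) = ln 2"
    by blast
  have y0: "y\<^sub>0 = 1 *\<^sub>R a' + 1 *\<^sub>R b'" using sum' by simp
  have "\<exists>c>0. A *\<^sub>R a' + B *\<^sub>R b' = c *\<^sub>R G (A *\<^sub>R a + B *\<^sub>R b)" if AB: "0 < A" "0 < B" for A B
  proof -
    define q where "q = A *\<^sub>R a + B *\<^sub>R b"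
    define \<rho> where "\<rho> = ln (A / B)"
    have qK: "q \<in> S1.K" unfolding q_def S1.chord_K_iff[OF ch] using AB by simp
    have Dq: "S1.D q u\<^sub>1 = \<bar>\<rho>\<bar>" "S1.D u\<^sub>1 q = \<bar>\<rho>\<bar>"
      unfolding u q_def using S1.chord_D[OF ch, of A B 1 1] S1.chord_D[OF ch, of 1 1 A B] AB
      by (simp_all add: \<rho>_def)
    have Dqp: "S1.D q p = \<bar>\<rho> - ln 2\<bar>" "S1.D p q = \<bar>\<rho> - ln 2\<bar>"
      unfolding p_def q_def using S1.chord_D[OF ch, of A B 2 1] S1.chord_D[OF ch, of 2 1 A B] AB
      by (simp_all add: \<rho>_def)
    have Dup: "S1.D u\<^sub>1 p = ln 2" unfolding u p_def using S1.chord_D[OF ch, of 1 1 2 1] by simp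
    have l2: "ln (2::real) > 0" by simp
    have y0n: "y\<^sub>0 \<noteq> 0" using y0_in_K S2.zero_notin_K by metis
    have "G q \<in> span {y\<^sub>0, G p}"
    proof -
      \<comment> \<open>On the chord viewed as a real line, \<open>u\<^sub>1\<close> sits at 0,
        \<open>p\<close> at \<open>ln 2\<close> and \<open>q\<close> at \<rho>. The cases say which
        point is in the middle; in the outer two the span relation has to be solved for
        \<open>G q\<close>.\<close>
      consider "\<rho> < 0" | "0 \<le> \<rho>" "\<rho> \<le> ln 2" | "\<rho> > ln 2" by linarith
      then show ?thesis
      proof cases
        case 1
        then have "y\<^sub>0 \<in> span {G q, G p}"
          unfolding y\<^sub>0_def using Dqp Dq Dup l2 by (intro G_D_add_span S1.u_in_K pK qK) auto
        moreover have "y\<^sub>0 \<notin> span {G p}"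
        proof
          assume "y\<^sub>0 \<in> span {G p}"
          then obtain k where "y\<^sub>0 = k *\<^sub>R G p" by (auto simp: span_singleton)
          then have k: "k *\<^sub>R G p = 1 *\<^sub>R y\<^sub>0" by simp
          then have "G p = (1 / k) *\<^sub>R y\<^sub>0" using y0n by (intro scaleR_eq_scaleR_imp) auto
          then show False using Gp by (metis rangeI span_singleton)
        qed
        ultimately show ?thesis by (metis in_span_insert)
      next
        case 2
        then show ?thesis
          unfolding y\<^sub>0_def using Dqp Dq Dup l2 by (intro G_D_add_span S1.u_in_K pK qK) auto
      next
        case 3
        then have "G p \<in> span {G q, y\<^sub>0}"
          unfolding y\<^sub>0_def using Dqp Dq Dp l2 by (intro G_D_add_span S1.u_in_K pK qK) auto
        then have "G q \<in> span {G p, y\<^sub>0}" using in_span_insert Gp by metis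
        then show ?thesis by (simp add: insert_commute)
      qed
    qed
    also have "span {y\<^sub>0, G p} \<subseteq> span {a', b'}"
    proof (intro span_minimal subspace_span)
      have "a' \<in> span {a', b'}" "b' \<in> span {a', b'}" by (simp_all add: span_base)
      then show "{y\<^sub>0, G p} \<subseteq> span {a', b'}" unfolding G y0 by (simp add: span_add span_scale)
    qed
    finally obtain \<alpha>' \<beta>' where Gq: "G q = \<alpha>' *\<^sub>R a' + \<beta>' *\<^sub>R b'"
      by (rule span_pairE)
    have pos': "0 < \<alpha>'" "0 < \<beta>'" using G_in[OF qK] S2.chord_K_iff[OF ch'] Gq by auto
    have "\<bar>ln (\<alpha>' / \<beta>')\<bar> = \<bar>\<rho>\<bar>"
      using G_isometric[OF qK S1.u_in_K] Dq S2.chord_D[OF ch' pos', of 1 1] Gq y0 by (simp add: y\<^sub>0_def)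
    moreover have "\<bar>ln (\<alpha>' / \<beta>') - ln 2\<bar> = \<bar>\<rho> - ln 2\<bar>"
      using G_isometric[OF qK pK] Dqp S2.chord_D[OF ch' pos' pos] Gq G ratio by simp
    \<comment> \<open>A point of the real line is determined by its distances to the two distinct
      points 0 and \<open>ln 2\<close>.\<close>
    ultimately have "ln (\<alpha>' / \<beta>') = ln (A / B)" using l2 unfolding \<rho>_def by linarith
    then have "\<alpha>' / \<beta>' = A / B" using pos' AB by (simp add: ln_inj_iff)
    then have "B = (A / \<alpha>') * \<beta>'" using pos' AB by (simp add: field_simps)
    then have "A *\<^sub>R a' + B *\<^sub>R b' = (A / \<alpha>') *\<^sub>R G q"
      using pos' unfolding Gq by (simp add: scaleR_add_right)
    then show ?thesis using pos' AB unfolding q_def by (intro exI[of _ "A / \<alpha>'"]) auto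
  qed
  then show thesis using that ch sum ch' sum' xst by blast
qed

section \<open>Linear lifts on the planes through \<open>u\<^sub>1\<close>\<close>

text \<open>\<open>lift x y\<close>: the linear map of \<open>span {u\<^sub>1, x}\<close> with \<open>u\<^sub>1 \<mapsto> y\<^sub>0\<close> and \<open>x \<mapsto> y\<close> induces \<open>G\<close> on rays.\<close>

definition lift :: "'a \<Rightarrow> 'b \<Rightarrow> bool" where
  "lift x y \<longleftrightarrow> y \<in> X\<^sub>2 \<and>
     (\<forall>s t. s *\<^sub>R u\<^sub>1 + t *\<^sub>R x \<in> S1.K \<longrightarrow> (\<exists>c>0. s *\<^sub>R y\<^sub>0 + t *\<^sub>R y = c *\<^sub>R G (s *\<^sub>R u\<^sub>1 + t *\<^sub>R x)))"

lemma lift_multiple: "lift (c *\<^sub>R u\<^sub>1) (c *\<^sub>R y\<^sub>0)"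
  unfolding lift_def
proof (intro conjI allI impI)
  fix s t assume "s *\<^sub>R u\<^sub>1 + t *\<^sub>R c *\<^sub>R u\<^sub>1 \<in> S1.K"
  then have K: "(s + t * c) *\<^sub>R u\<^sub>1 \<in> S1.K" by (simp add: algebra_simps)
  then have pos: "s + t * c > 0" using S1.scale_K_in_K_iff[OF S1.u_in_K] by simp
  then obtain d where d: "d > 0" "G ((s + t * c) *\<^sub>R u\<^sub>1) = d *\<^sub>R y\<^sub>0"
    using G_scale[OF S1.u_in_K] by (auto simp: y\<^sub>0_def)
  have e: "s *\<^sub>R u\<^sub>1 + t *\<^sub>R c *\<^sub>R u\<^sub>1 = (s + t * c) *\<^sub>R u\<^sub>1"
    "s *\<^sub>R y\<^sub>0 + t *\<^sub>R c *\<^sub>R y\<^sub>0 = (s + t * c) *\<^sub>R y\<^sub>0"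
    by (simp_all add: algebra_simps)
  show "\<exists>k>0. s *\<^sub>R y\<^sub>0 + t *\<^sub>R c *\<^sub>R y\<^sub>0 = k *\<^sub>R G (s *\<^sub>R u\<^sub>1 + t *\<^sub>R c *\<^sub>R u\<^sub>1)"
    unfolding e d(2) using pos d(1) by (intro exI[of _ "(s + t * c) / d"]) simp
qed (use y0_in_K in simp)

text \<open>Keep the coordinates of \<open>x\<close> along its chord and replace the chord by its
  image. Membership in either cone is decided by the signs of the same coordinates, which is the
  source of bipositivity.\<close>

lemma lift_exists:
  assumes x: "x \<in> X\<^sub>1"
  shows "\<exists>y. lift x y \<and> (y \<in> C\<^sub>2 \<longleftrightarrow> x \<in> C\<^sub>1)"
proof (cases "x \<in> span {u\<^sub>1}")
  case True
  then obtain c where "x = c *\<^sub>R u\<^sub>1" by (auto simp: span_singleton)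
  then show ?thesis
    using lift_multiple[of c] S1.scale_K_in_C_iff[OF S1.u_in_K] S2.scale_K_in_C_iff[OF y0_in_K] by metis
next
  case False
  obtain a b a' b' s t where ch: "S1.chord a b" and sum: "a + b = u\<^sub>1" and ch': "S2.chord a' b'"
    and sum': "a' + b' = y\<^sub>0" and xst: "x = s *\<^sub>R a + t *\<^sub>R b"
    and G: "\<And>A B. 0 < A \<Longrightarrow> 0 < B \<Longrightarrow> \<exists>c>0. A *\<^sub>R a' + B *\<^sub>R b' = c *\<^sub>R G (A *\<^sub>R a + B *\<^sub>R b)"
    using G_chord[OF x False] by blast
  define y where "y = s *\<^sub>R a' + t *\<^sub>R b'"
  have "lift x y"
    unfolding lift_def
  proof (intro conjI allI impI)
    show "y \<in> X\<^sub>2" using ch' by (simp add: y_def S2.chord_def)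
    fix k l assume K: "k *\<^sub>R u\<^sub>1 + l *\<^sub>R x \<in> S1.K"
    have e1: "k *\<^sub>R u\<^sub>1 + l *\<^sub>R x = (k + l * s) *\<^sub>R a + (k + l * t) *\<^sub>R b"
      by (simp add: xst algebra_simps flip: sum)
    have e2: "k *\<^sub>R y\<^sub>0 + l *\<^sub>R y = (k + l * s) *\<^sub>R a' + (k + l * t) *\<^sub>R b'"
      by (simp add: y_def algebra_simps flip: sum')
    show "\<exists>c>0. k *\<^sub>R y\<^sub>0 + l *\<^sub>R y = c *\<^sub>R G (k *\<^sub>R u\<^sub>1 + l *\<^sub>R x)"
      using K G unfolding e1 e2 S1.chord_K_iff[OF ch] by blast
  qed
  then show ?thesis using S1.chord_C_iff[OF ch] S2.chord_C_iff[OF ch'] xst y_def by metis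
qed

lemma lift_large:
  assumes x: "x \<in> X\<^sub>1"
  obtains s where "s > 0" "s *\<^sub>R u\<^sub>1 + x \<in> S1.K" "s *\<^sub>R u\<^sub>1 - x \<in> S1.K"
proof -
  obtain s s' where "s > 0" "\<forall>r\<ge>s. r *\<^sub>R u\<^sub>1 + x \<in> S1.K" "\<forall>r\<ge>s'. r *\<^sub>R u\<^sub>1 + - x \<in> S1.K"
    using S1.K_absorbs_large[OF S1.u_in_K, of x] S1.K_absorbs_large[OF S1.u_in_K, of "- x"] x by auto
  then show thesis using that[of "max s s'"] by simp
qed

text \<open>Here \<open>y = d *\<^sub>R y\<^sub>0\<close>, and \<open>s + t * c > 0\<close> implies
  \<open>s + t * d > 0\<close>. Testing \<open>s = - d\<close>, \<open>t = 1\<close> and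
  \<open>s = d\<close>, \<open>t = - 1\<close> makes the conclusion \<open>0 > 0\<close>, so
  \<open>d\<close> cannot differ from \<open>c\<close> on either side.\<close>

lemma lift_multiple_unique:
  assumes "lift (c *\<^sub>R u\<^sub>1) y" shows "y = c *\<^sub>R y\<^sub>0"
proof -
  have pos: "\<exists>k>0. s *\<^sub>R y\<^sub>0 + t *\<^sub>R y = k *\<^sub>R y\<^sub>0" if st: "s + t * c > 0" for s t
  proof -
    have "s *\<^sub>R u\<^sub>1 + t *\<^sub>R c *\<^sub>R u\<^sub>1 = (s + t * c) *\<^sub>R u\<^sub>1" by (simp add: algebra_simps)
    moreover obtain d where "d > 0" "G ((s + t * c) *\<^sub>R u\<^sub>1) = d *\<^sub>R y\<^sub>0"
      using G_scale[OF S1.u_in_K st] by (auto simp: y\<^sub>0_def)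
    moreover have "(s + t * c) *\<^sub>R u\<^sub>1 \<in> S1.K" using S1.scale_K_in_K_iff[OF S1.u_in_K] that by simp
    ultimately show ?thesis using assms unfolding lift_def by (metis mult_pos_pos scaleR_scaleR)
  qed
  obtain k where "(1 - c) *\<^sub>R y\<^sub>0 + 1 *\<^sub>R y = k *\<^sub>R y\<^sub>0" using pos[of "1 - c" 1] by auto
  then have y: "y = (k - (1 - c)) *\<^sub>R y\<^sub>0" by (simp add: algebra_simps)
  define d where "d = k - (1 - c)"
  have dpos: "s + t * d > 0" if st: "s + t * c > 0" for s t
  proof -
    obtain k where k: "k > 0" "s *\<^sub>R y\<^sub>0 + t *\<^sub>R y = k *\<^sub>R y\<^sub>0" using pos[OF st] by auto
    then have "(s + t * d) *\<^sub>R y\<^sub>0 = k *\<^sub>R y\<^sub>0" by (simp add: y d_def algebra_simps)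
    then show ?thesis using k y0_in_K S2.zero_notin_K by (metis scaleR_cancel_right)
  qed
  have "d \<ge> c"
  proof (rule ccontr)
    assume "\<not> d \<ge> c"
    then show False using dpos[of "- d" 1] by simp
  qed
  moreover have "d \<le> c"
  proof (rule ccontr)
    assume "\<not> d \<le> c"
    then show False using dpos[of d "- 1"] by simp
  qed
  ultimately show ?thesis using y d_def by simp
qed

text \<open>For every lift \<open>y\<close>, the vectors \<open>s *\<^sub>R y\<^sub>0 + y\<close>
  and \<open>s *\<^sub>R y\<^sub>0 - y\<close> lie on two fixed rays and add up to
  \<open>(2 * s) *\<^sub>R y\<^sub>0\<close>. Since \<open>G\<close> is injective on rays,
  \<open>y\<close> is not a multiple of \<open>y\<^sub>0\<close>, so the factors between two lifts
  must both be 1.\<close>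

lemma lift_unique:
  assumes x: "x \<in> X\<^sub>1" and y: "lift x y" and y': "lift x y'"
  shows "y = y'"
proof (cases "x \<in> span {u\<^sub>1}")
  case True
  then show ?thesis using lift_multiple_unique y y' by (auto simp: span_singleton)
next
  case False
  obtain s where s: "s > 0" "s *\<^sub>R u\<^sub>1 + x \<in> S1.K" "s *\<^sub>R u\<^sub>1 - x \<in> S1.K" using lift_large[OF x] .
  have L: "\<exists>c>0. s *\<^sub>R y\<^sub>0 + z = c *\<^sub>R G (s *\<^sub>R u\<^sub>1 + x)" "\<exists>c>0. s *\<^sub>R y\<^sub>0 - z = c *\<^sub>R G (s *\<^sub>R u\<^sub>1 - x)"
    if "lift x z" for z
  proof -
    have "s *\<^sub>R u\<^sub>1 + 1 *\<^sub>R x \<in> S1.K" "s *\<^sub>R u\<^sub>1 + (- 1) *\<^sub>R x \<in> S1.K" using s by simp_all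
    then have "\<exists>c>0. s *\<^sub>R y\<^sub>0 + 1 *\<^sub>R z = c *\<^sub>R G (s *\<^sub>R u\<^sub>1 + 1 *\<^sub>R x)"
      "\<exists>c>0. s *\<^sub>R y\<^sub>0 + (- 1) *\<^sub>R z = c *\<^sub>R G (s *\<^sub>R u\<^sub>1 + (- 1) *\<^sub>R x)"
      using that unfolding lift_def by blast+
    then show "\<exists>c>0. s *\<^sub>R y\<^sub>0 + z = c *\<^sub>R G (s *\<^sub>R u\<^sub>1 + x)" "\<exists>c>0. s *\<^sub>R y\<^sub>0 - z = c *\<^sub>R G (s *\<^sub>R u\<^sub>1 - x)"
      by simp_all
  qed
  have y_ns: "y \<notin> span {y\<^sub>0}"
  proof
    assume "y \<in> span {y\<^sub>0}"
    then obtain d where d: "y = d *\<^sub>R y\<^sub>0" by (auto simp: span_singleton)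
    obtain c where c: "c > 0" "s *\<^sub>R y\<^sub>0 + y = c *\<^sub>R G (s *\<^sub>R u\<^sub>1 + x)" using L y by blast
    then have e: "(s + d) *\<^sub>R y\<^sub>0 = c *\<^sub>R G (s *\<^sub>R u\<^sub>1 + x)" by (simp add: d algebra_simps)
    then have "(s + d) *\<^sub>R y\<^sub>0 \<in> S2.K" using G_in s c S2.K_scale by metis
    then have "s + d > 0" using S2.scale_K_in_K_iff[OF y0_in_K] by simp
    moreover have "G (s *\<^sub>R u\<^sub>1 + x) = ((s + d) / c) *\<^sub>R G u\<^sub>1"
      using scaleR_eq_scaleR_imp[OF e[symmetric]] c by (simp add: y\<^sub>0_def)
    ultimately obtain k where "s *\<^sub>R u\<^sub>1 + x = k *\<^sub>R u\<^sub>1"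
      using G_proportional[OF s(2) S1.u_in_K, of "(s + d) / c"] c by auto
    then have "x = (k - s) *\<^sub>R u\<^sub>1" by (simp add: algebra_simps)
    then show False using False by (auto simp: span_singleton)
  qed
  have ratio: "\<exists>r. s *\<^sub>R y\<^sub>0 + y' = r *\<^sub>R (s *\<^sub>R y\<^sub>0 + y)" "\<exists>r. s *\<^sub>R y\<^sub>0 - y' = r *\<^sub>R (s *\<^sub>R y\<^sub>0 - y)"
  proof -
    have "\<exists>r. v = r *\<^sub>R w" if "c > 0" "w = c *\<^sub>R g" "v = d *\<^sub>R g" for v w g :: 'b and c d
      using that by (intro exI[of _ "d / c"]) simp
    then show "\<exists>r. s *\<^sub>R y\<^sub>0 + y' = r *\<^sub>R (s *\<^sub>R y\<^sub>0 + y)" "\<exists>r. s *\<^sub>R y\<^sub>0 - y' = r *\<^sub>R (s *\<^sub>R y\<^sub>0 - y)"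
      using L[OF y] L[OF y'] by blast+
  qed
  then obtain r r' where r: "s *\<^sub>R y\<^sub>0 + y' = r *\<^sub>R (s *\<^sub>R y\<^sub>0 + y)" "s *\<^sub>R y\<^sub>0 - y' = r' *\<^sub>R (s *\<^sub>R y\<^sub>0 - y)"
    by blast
  have "(2 * s) *\<^sub>R y\<^sub>0 = (s *\<^sub>R y\<^sub>0 + y') + (s *\<^sub>R y\<^sub>0 - y')"
    by (simp flip: scaleR_left.add)
  also have "\<dots> = r *\<^sub>R (s *\<^sub>R y\<^sub>0 + y) + r' *\<^sub>R (s *\<^sub>R y\<^sub>0 - y)" by (simp only: r)
  finally have eq: "(r' - r) *\<^sub>R y = ((r + r' - 2) * s) *\<^sub>R y\<^sub>0"
    by (simp add: algebra_simps)
  have rr: "r = r'"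
  proof (rule ccontr)
    assume "r \<noteq> r'"
    then have "y = (((r + r' - 2) * s) / (r' - r)) *\<^sub>R y\<^sub>0"
      using scaleR_eq_scaleR_imp[OF eq] by simp
    then show False using y_ns by (auto simp: span_singleton)
  qed
  have "y\<^sub>0 \<noteq> 0" using y0_in_K S2.zero_notin_K by metis
  then have "r = 1" using eq rr s by simp
  then show ?thesis using r by simp
qed

section \<open>The glued map and its linearity\<close>

definition T :: "'a \<Rightarrow> 'b" where "T x = (SOME y. lift x y)"

lemma T_lift: "x \<in> X\<^sub>1 \<Longrightarrow> lift x (T x)"
  unfolding T_def using lift_exists by (metis someI_ex)

lemma T_eqI: "x \<in> X\<^sub>1 \<Longrightarrow> lift x y \<Longrightarrow> T x = y"
  using lift_unique T_lift by blast

lemma T_in: "x \<in> X\<^sub>1 \<Longrightarrow> T x \<in> X\<^sub>2"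
  using T_lift by (auto simp: lift_def)

lemma T_bipositive: "x \<in> X\<^sub>1 \<Longrightarrow> T x \<in> C\<^sub>2 \<longleftrightarrow> x \<in> C\<^sub>1"
  using lift_exists T_eqI by metis

text \<open>The vector stays in the plane of \<open>u\<^sub>1\<close> and \<open>x\<close>, where
  the lift is already determined by \<open>T x\<close>.\<close>

lemma T_affine:
  assumes x: "x \<in> X\<^sub>1"
  shows "T (k *\<^sub>R x + l *\<^sub>R u\<^sub>1) = k *\<^sub>R T x + l *\<^sub>R y\<^sub>0"
proof (rule T_eqI)
  show "lift (k *\<^sub>R x + l *\<^sub>R u\<^sub>1) (k *\<^sub>R T x + l *\<^sub>R y\<^sub>0)"
    unfolding lift_def
  proof (intro conjI allI impI)
    fix s t assume "s *\<^sub>R u\<^sub>1 + t *\<^sub>R (k *\<^sub>R x + l *\<^sub>R u\<^sub>1) \<in> S1.K"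
    moreover have e: "s *\<^sub>R u\<^sub>1 + t *\<^sub>R (k *\<^sub>R x + l *\<^sub>R u\<^sub>1) = (s + t * l) *\<^sub>R u\<^sub>1 + (t * k) *\<^sub>R x"
      "s *\<^sub>R y\<^sub>0 + t *\<^sub>R (k *\<^sub>R T x + l *\<^sub>R y\<^sub>0) = (s + t * l) *\<^sub>R y\<^sub>0 + (t * k) *\<^sub>R T x"
      by (simp_all add: algebra_simps)
    ultimately show "\<exists>c>0. s *\<^sub>R y\<^sub>0 + t *\<^sub>R (k *\<^sub>R T x + l *\<^sub>R y\<^sub>0) = c *\<^sub>R G (s *\<^sub>R u\<^sub>1 + t *\<^sub>R (k *\<^sub>R x + l *\<^sub>R u\<^sub>1))"
      using T_lift[OF x] unfolding e lift_def by blast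
  qed (use x T_in y0_in_K in simp)
qed (use x S1.u_in_C in simp)

lemma T_u: "T u\<^sub>1 = y\<^sub>0"
  using T_eqI[OF _ lift_multiple[of 1]] S1.u_in_C by simp

lemma T_scale: "x \<in> X\<^sub>1 \<Longrightarrow> T (k *\<^sub>R x) = k *\<^sub>R T x"
  using T_affine[of x k 0] by simp

lemma T_G: "x \<in> S1.K \<Longrightarrow> \<exists>c>0. T x = c *\<^sub>R G x"
  using T_lift[of x] unfolding lift_def
  by (metis S1.K_X add_0 scaleR_one scaleR_zero_left)

lemma T_sum_span:
  assumes x: "x \<in> S1.K" and y: "y \<in> S1.K"
  shows "T (x + y) \<in> span {T x, T y}"
proof -
  have "G (x + y) \<in> span {G x, G y}"
    using G_D_add_span[OF x S1.K_add[OF x y] y] S1.D_sum[OF x y] by simp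
  moreover obtain k l m where T: "k > 0" "T x = k *\<^sub>R G x" "l > 0" "T y = l *\<^sub>R G y"
    "T (x + y) = m *\<^sub>R G (x + y)"
    using T_G[OF x] T_G[OF y] T_G[OF S1.K_add[OF x y]] by auto
  moreover have "span {G x, G y} \<subseteq> span {T x, T y}"
  proof (intro span_minimal subspace_span)
    have "G x = (1 / k) *\<^sub>R T x" "G y = (1 / l) *\<^sub>R T y" using T by auto
    then show "{G x, G y} \<subseteq> span {T x, T y}"
      using span_scale span_base by (metis (no_types, lifting) empty_subsetI insertI1 insertI2 insert_subset)
  qed
  ultimately show ?thesis by (auto intro: span_scale)
qed

text \<open>Independence has to be carried to the target before \<open>T\<close> is known to be
  linear. The candidate \<open>v\<close> has \<open>T v = T w\<close>; a common shift by
  \<open>u\<^sub>1\<close> makes both interior, so their \<open>G\<close>-values are proportional,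
  and injectivity of \<open>G\<close> on rays makes the shifted vectors proportional.\<close>

lemma T_span_reflect:
  assumes z: "z \<in> X\<^sub>1" and w: "w \<in> X\<^sub>1" and sp: "T w \<in> span {y\<^sub>0, T z}"
  shows "w \<in> span {u\<^sub>1, z}"
proof -
  obtain k l where kl: "T w = k *\<^sub>R T z + l *\<^sub>R y\<^sub>0"
    using sp by (metis span_pairE add.commute)
  define v where "v = k *\<^sub>R z + l *\<^sub>R u\<^sub>1"
  have v: "v \<in> X\<^sub>1" using z S1.u_in_C by (simp add: v_def)
  have Tv: "T v = T w" using T_affine[OF z] kl by (simp add: v_def)
  obtain s s' where "\<forall>r\<ge>s. r *\<^sub>R u\<^sub>1 + v \<in> S1.K" "\<forall>r\<ge>s'. r *\<^sub>R u\<^sub>1 + w \<in> S1.K"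
    using S1.K_absorbs_large[OF S1.u_in_K v] S1.K_absorbs_large[OF S1.u_in_K w] by auto
  then obtain r where K: "r *\<^sub>R u\<^sub>1 + v \<in> S1.K" "r *\<^sub>R u\<^sub>1 + w \<in> S1.K"
    by (metis max.cobounded1 max.cobounded2)
  have "T (r *\<^sub>R u\<^sub>1 + v) = T (r *\<^sub>R u\<^sub>1 + w)"
    using T_affine[OF v, of 1 r] T_affine[OF w, of 1 r] Tv by (simp add: add.commute)
  then obtain c d where cd: "c > 0" "d > 0" "c *\<^sub>R G (r *\<^sub>R u\<^sub>1 + w) = d *\<^sub>R G (r *\<^sub>R u\<^sub>1 + v)"
    using T_G[OF K(1)] T_G[OF K(2)] by auto
  then have "G (r *\<^sub>R u\<^sub>1 + w) = (d / c) *\<^sub>R G (r *\<^sub>R u\<^sub>1 + v)"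
    by (intro scaleR_eq_scaleR_imp) auto
  then obtain m where m: "r *\<^sub>R u\<^sub>1 + w = m *\<^sub>R (r *\<^sub>R u\<^sub>1 + v)"
    using G_proportional[OF K(2,1), of "d / c"] cd by auto
  have "w = m *\<^sub>R (r *\<^sub>R u\<^sub>1 + v) - r *\<^sub>R u\<^sub>1" unfolding m[symmetric] by simp
  then show ?thesis
    unfolding v_def by (auto intro!: span_diff span_add span_scale intro: span_base)
qed

lemma T_add:
  assumes z: "z \<in> X\<^sub>1" and w: "w \<in> X\<^sub>1"
  shows "T (z + w) = T z + T w"
proof -
  consider (dep) "w \<in> span {u\<^sub>1, z}" | (z) "z \<in> span {u\<^sub>1}" | (indep) "w \<notin> span {u\<^sub>1, z}" "z \<notin> span {u\<^sub>1}"
    by blast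
  then show ?thesis
  proof cases
    case dep
    then obtain k l where kl: "w = k *\<^sub>R z + l *\<^sub>R u\<^sub>1" by (metis span_pairE add.commute)
    have "z + w = (1 + k) *\<^sub>R z + l *\<^sub>R u\<^sub>1" by (simp add: kl algebra_simps)
    then show ?thesis
      using T_affine[OF z, of "1 + k" l] T_affine[OF z, of k l] kl by (simp add: algebra_simps)
  next
    case z
    then obtain k where "z = k *\<^sub>R u\<^sub>1" by (auto simp: span_singleton)
    then show ?thesis
      using T_affine[OF w, of 1 k] T_scale[of u\<^sub>1 k] S1.u_in_C T_u by (simp add: add.commute)
  next
    case indep
    define a b c where "a = T z" and "b = T w" and "c = T (z + w)"
    have b_ns: "b \<notin> span {y\<^sub>0, a}" using T_span_reflect[OF z w] indep by (auto simp: a_def b_def)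
    have a_ns: "a \<notin> span {y\<^sub>0}"
      using T_span_reflect[of u\<^sub>1 z] indep z S1.u_in_C T_u by (auto simp: a_def)
    have coeffs: "\<alpha> = 0 \<and> \<beta> = 0 \<and> \<gamma> = 0" if "\<alpha> *\<^sub>R y\<^sub>0 + \<beta> *\<^sub>R a + \<gamma> *\<^sub>R b = 0" for \<alpha> \<beta> \<gamma>
    proof -
      have "\<gamma> = 0"
      proof (rule ccontr)
        assume g: "\<gamma> \<noteq> 0"
        have "\<gamma> *\<^sub>R b = (\<alpha> *\<^sub>R y\<^sub>0 + \<beta> *\<^sub>R a + \<gamma> *\<^sub>R b) + ((- \<alpha>) *\<^sub>R y\<^sub>0 + (- \<beta>) *\<^sub>R a)" by simp
        then have "\<gamma> *\<^sub>R b = 1 *\<^sub>R ((- \<alpha>) *\<^sub>R y\<^sub>0 + (- \<beta>) *\<^sub>R a)" unfolding that by simp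
        then have "b = (1 / \<gamma>) *\<^sub>R ((- \<alpha>) *\<^sub>R y\<^sub>0 + (- \<beta>) *\<^sub>R a)"
          using g by (rule scaleR_eq_scaleR_imp)
        then show False using b_ns by (metis span_add span_scale span_base insertI1 insertI2)
      qed
      moreover have "\<beta> = 0"
      proof (rule ccontr)
        assume g: "\<beta> \<noteq> 0"
        have "\<beta> *\<^sub>R a = (- \<alpha>) *\<^sub>R y\<^sub>0" using that \<open>\<gamma> = 0\<close> by (simp add: eq_neg_iff_add_eq_0 add.commute)
        then have "a = (- \<alpha> / \<beta>) *\<^sub>R y\<^sub>0" using g by (rule scaleR_eq_scaleR_imp)
        then show False using a_ns by (metis span_scale span_base insertI1)
      qed
      moreover have "y\<^sub>0 \<noteq> 0" using y0_in_K S2.zero_notin_K by metis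
      ultimately show ?thesis using that by simp
    qed
    obtain s0 s1 where "\<forall>r\<ge>s0. r *\<^sub>R u\<^sub>1 + z \<in> S1.K" "\<forall>r\<ge>s1. r *\<^sub>R u\<^sub>1 + w \<in> S1.K"
      using S1.K_absorbs_large[OF S1.u_in_K z] S1.K_absorbs_large[OF S1.u_in_K w] by auto
    then have K: "s *\<^sub>R u\<^sub>1 + z \<in> S1.K" "s *\<^sub>R u\<^sub>1 + w \<in> S1.K" if "max s0 s1 \<le> s" for s
      using that by auto
    \<comment> \<open>The shifts by \<open>s\<close> and \<open>r\<close> leave the unknown
      \<open>c\<close> unchanged but vary the two spanning vectors independently; this freedom
      determines \<open>c\<close>.\<close>
    have rel: "\<exists>\<mu> \<nu>. (s + r) *\<^sub>R y\<^sub>0 + c = \<mu> *\<^sub>R (s *\<^sub>R y\<^sub>0 + a) + \<nu> *\<^sub>R (r *\<^sub>R y\<^sub>0 + b)"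
      if sr: "max s0 s1 \<le> s" "max s0 s1 \<le> r" for s r
    proof -
      have "T ((s *\<^sub>R u\<^sub>1 + z) + (r *\<^sub>R u\<^sub>1 + w)) \<in> span {T (s *\<^sub>R u\<^sub>1 + z), T (r *\<^sub>R u\<^sub>1 + w)}"
        by (rule T_sum_span) (use K sr in auto)
      moreover have "(s *\<^sub>R u\<^sub>1 + z) + (r *\<^sub>R u\<^sub>1 + w) = 1 *\<^sub>R (z + w) + (s + r) *\<^sub>R u\<^sub>1"
        by (simp add: algebra_simps)
      moreover have "T (1 *\<^sub>R (z + w) + (s + r) *\<^sub>R u\<^sub>1) = (s + r) *\<^sub>R y\<^sub>0 + c"
        using T_affine[of "z + w" 1 "s + r"] z w by (simp add: c_def add.commute)
      moreover have "T (s *\<^sub>R u\<^sub>1 + z) = s *\<^sub>R y\<^sub>0 + a" "T (r *\<^sub>R u\<^sub>1 + w) = r *\<^sub>R y\<^sub>0 + b"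
        using T_affine[OF z, of 1 s] T_affine[OF w, of 1 r] by (simp_all add: a_def b_def add.commute)
      ultimately have "(s + r) *\<^sub>R y\<^sub>0 + c \<in> span {s *\<^sub>R y\<^sub>0 + a, r *\<^sub>R y\<^sub>0 + b}" by simp
      then show ?thesis by (metis span_pairE)
    qed
    define m where "m = max s0 s1"
    obtain \<mu> \<nu> where e: "(m + m) *\<^sub>R y\<^sub>0 + c = \<mu> *\<^sub>R (m *\<^sub>R y\<^sub>0 + a) + \<nu> *\<^sub>R (m *\<^sub>R y\<^sub>0 + b)"
      using rel[of m m] by (auto simp: m_def)
    \<comment> \<open>The coefficient of \<open>y\<^sub>0\<close> in \<open>c\<close>, read off from
      the relation at \<open>s = r = m\<close>.\<close>
    define \<gamma> where "\<gamma> = m * \<mu> + m * \<nu> - (m + m)"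
    have c: "c = \<gamma> *\<^sub>R y\<^sub>0 + \<mu> *\<^sub>R a + \<nu> *\<^sub>R b"
    proof -
      have "c = ((m + m) *\<^sub>R y\<^sub>0 + c) - (m + m) *\<^sub>R y\<^sub>0" by simp
      then show ?thesis unfolding e \<gamma>_def by (simp add: algebra_simps)
    qed
    \<comment> \<open>By independence of \<open>y\<^sub>0\<close>, \<open>a\<close>,
      \<open>b\<close>, the coefficients \<mu> and \<nu> found at \<open>m\<close> serve all larger
      \<open>s\<close> and \<open>r\<close>.\<close>
    have "s + r + \<gamma> = s * \<mu> + r * \<nu>" if sr: "m \<le> s" "m \<le> r" for s r
    proof -
      obtain \<mu>' \<nu>' where "(s + r) *\<^sub>R y\<^sub>0 + c = \<mu>' *\<^sub>R (s *\<^sub>R y\<^sub>0 + a) + \<nu>' *\<^sub>R (r *\<^sub>R y\<^sub>0 + b)"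
        using rel[of s r] sr by (auto simp: m_def)
      then have "(s + r + \<gamma> - s * \<mu>' - r * \<nu>') *\<^sub>R y\<^sub>0 + (\<mu> - \<mu>') *\<^sub>R a + (\<nu> - \<nu>') *\<^sub>R b = 0"
        unfolding c by (simp add: algebra_simps)
      then have "s + r + \<gamma> - s * \<mu>' - r * \<nu>' = 0 \<and> \<mu> - \<mu>' = 0 \<and> \<nu> - \<nu>' = 0" by (rule coeffs)
      then show ?thesis by simp
    qed
    \<comment> \<open>Raising one argument by 1 gives \<open>\<mu> = 1\<close> and
      \<open>\<nu> = 1\<close>; the first instance then gives \<open>\<gamma> = 0\<close>.\<close>
    from this[of m m] this[of "m + 1" m] this[of m "m + 1"]
    have "\<mu> = 1" "\<nu> = 1" "\<gamma> = 0" by (simp_all add: algebra_simps)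
    then show ?thesis using c by (simp add: a_def b_def c_def)
  qed
qed

lemma T_K: "x \<in> S1.K \<Longrightarrow> T x \<in> S2.K"
  using T_G G_in S2.K_scale by metis

end

section \<open>Transfer through the identifications\<close>

theorem theorem1p1:
  fixes \<Omega>\<^sub>1 :: "'a::real_vector set" and \<Omega>\<^sub>2 :: "'b::real_vector set"
    and X\<^sub>1 C\<^sub>1 :: "'c::real_vector set" and X\<^sub>2 C\<^sub>2 :: "'d::real_vector set"
    and u\<^sub>1 :: 'c and u\<^sub>2 :: 'd
    and \<phi>\<^sub>1 :: "'c \<Rightarrow> real" and \<phi>\<^sub>2 :: "'d \<Rightarrow> real"
    and \<iota>\<^sub>1 :: "'a \<Rightarrow> 'c" and \<iota>\<^sub>2 :: "'b \<Rightarrow> 'd"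
    and f :: "'a \<Rightarrow> 'b"
  assumes "convex \<Omega>\<^sub>1" and "\<Omega>\<^sub>1 \<noteq> {}" and "hilbert_well_defined \<Omega>\<^sub>1"
    and "convex \<Omega>\<^sub>2" and "\<Omega>\<^sub>2 \<noteq> {}" and "hilbert_well_defined \<Omega>\<^sub>2"
    and "order_unit_space X\<^sub>1 C\<^sub>1 u\<^sub>1" and "strictly_positive_state X\<^sub>1 C\<^sub>1 u\<^sub>1 \<phi>\<^sub>1"
    and "order_unit_space X\<^sub>2 C\<^sub>2 u\<^sub>2" and "strictly_positive_state X\<^sub>2 C\<^sub>2 u\<^sub>2 \<phi>\<^sub>2"
    and "affine_isomorphism \<Omega>\<^sub>1 (state_section X\<^sub>1 C\<^sub>1 u\<^sub>1 \<phi>\<^sub>1) \<iota>\<^sub>1"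
    and "affine_isomorphism \<Omega>\<^sub>2 (state_section X\<^sub>2 C\<^sub>2 u\<^sub>2 \<phi>\<^sub>2) \<iota>\<^sub>2"
    and "strictly_convex_section X\<^sub>1 C\<^sub>1 u\<^sub>1 \<phi>\<^sub>1"
    and "strictly_convex_section X\<^sub>2 C\<^sub>2 u\<^sub>2 \<phi>\<^sub>2"
    and "hilbert_isometry \<Omega>\<^sub>1 \<Omega>\<^sub>2 f"
  shows "projective_linear_hom X\<^sub>1 C\<^sub>1 u\<^sub>1 \<phi>\<^sub>1 X\<^sub>2 C\<^sub>2 u\<^sub>2 \<phi>\<^sub>2
           (\<iota>\<^sub>2 \<circ> f \<circ> inv_into \<Omega>\<^sub>1 \<iota>\<^sub>1)"
proof -
  let ?\<Sigma>\<^sub>1 = "state_section X\<^sub>1 C\<^sub>1 u\<^sub>1 \<phi>\<^sub>1" and ?\<Sigma>\<^sub>2 = "state_section X\<^sub>2 C\<^sub>2 u\<^sub>2 \<phi>\<^sub>2"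
  interpret S1: state_space X\<^sub>1 C\<^sub>1 u\<^sub>1 \<phi>\<^sub>1 by unfold_locales (fact assms)+
  interpret S2: state_space X\<^sub>2 C\<^sub>2 u\<^sub>2 \<phi>\<^sub>2 by unfold_locales (fact assms)+
  define F where "F = \<iota>\<^sub>2 \<circ> f \<circ> inv_into \<Omega>\<^sub>1 \<iota>\<^sub>1"
  \<comment> \<open>\<open>F\<close> lives on the section; normalising by the state extends it to
    the open cone, constant along rays.\<close>
  define G where "G x = F ((1 / \<phi>\<^sub>1 x) *\<^sub>R x)" for x
  have bij: "bij_betw \<iota>\<^sub>1 \<Omega>\<^sub>1 ?\<Sigma>\<^sub>1" "bij_betw \<iota>\<^sub>2 \<Omega>\<^sub>2 ?\<Sigma>\<^sub>2"
    using assms by (auto simp: affine_isomorphism_def)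
  have pre: "inv_into \<Omega>\<^sub>1 \<iota>\<^sub>1 x \<in> \<Omega>\<^sub>1" "\<iota>\<^sub>1 (inv_into \<Omega>\<^sub>1 \<iota>\<^sub>1 x) = x" if "x \<in> ?\<Sigma>\<^sub>1" for x
    using that bij(1) by (auto simp: bij_betw_def inv_into_into f_inv_into_f)
  have f_in: "f p \<in> \<Omega>\<^sub>2" if "p \<in> \<Omega>\<^sub>1" for p
    using that assms(15) by (auto simp: hilbert_isometry_def)
  have F_in: "F x \<in> ?\<Sigma>\<^sub>2" if "x \<in> ?\<Sigma>\<^sub>1" for x
    using pre(1)[OF that] f_in bij(2) by (auto simp: F_def dest: bij_betwE)
  have F_isometric: "S2.D (F x) (F y) = S1.D x y" if x: "x \<in> ?\<Sigma>\<^sub>1" and y: "y \<in> ?\<Sigma>\<^sub>1" for x y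
  proof -
    let ?p = "inv_into \<Omega>\<^sub>1 \<iota>\<^sub>1 x" and ?q = "inv_into \<Omega>\<^sub>1 \<iota>\<^sub>1 y"
    have "S2.D (F x) (F y) = hilbert_metric \<Omega>\<^sub>2 (f ?p) (f ?q)"
      using S2.hilbert_metric_eq_D[OF assms(12,4)] f_in pre x y by (simp add: F_def)
    also have "\<dots> = hilbert_metric \<Omega>\<^sub>1 ?p ?q"
      using assms(15) pre x y by (simp add: hilbert_isometry_def)
    also have "\<dots> = S1.D x y"
      using S1.hilbert_metric_eq_D[OF assms(11,1)] pre x y by simp
    finally show ?thesis .
  qed
  have norm_in: "(1 / \<phi>\<^sub>1 x) *\<^sub>R x \<in> ?\<Sigma>\<^sub>1" if "x \<in> S1.K" for x
    using that S1.phi_K[OF that] S1.K_scale by (simp add: state_section_def)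
  interpret hilbert_embedding X\<^sub>1 C\<^sub>1 u\<^sub>1 \<phi>\<^sub>1 X\<^sub>2 C\<^sub>2 u\<^sub>2 \<phi>\<^sub>2 G
  proof
    fix x assume x: "x \<in> S1.K"
    show "G x \<in> S2.K" using F_in[OF norm_in[OF x]] by (simp add: G_def state_section_def)
    fix y assume y: "y \<in> S1.K"
    show "S2.D (G x) (G y) = S1.D x y"
      using F_isometric[OF norm_in[OF x] norm_in[OF y]] S1.D_scale[OF x y] S1.phi_K x y
      by (simp add: G_def)
  qed (fact assms)
  have "T \<in> X\<^sub>1 \<rightarrow> X\<^sub>2" "linear_on X\<^sub>1 T" "bipositive X\<^sub>1 C\<^sub>1 C\<^sub>2 T"
    using T_in T_add T_scale T_bipositive by (auto simp: linear_on_def bipositive_def)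
  moreover have "T x \<in> S2.K \<and> F x = T x /\<^sub>R \<phi>\<^sub>2 (T x)" if x: "x \<in> ?\<Sigma>\<^sub>1" for x
  proof -
    have K: "x \<in> S1.K" and "G x = F x" using x by (auto simp: state_section_def G_def)
    then obtain c where c: "c > 0" "T x = c *\<^sub>R F x" using T_G by metis
    \<comment> \<open>As \<open>F x\<close> has state 1, the factor \<open>c\<close> is
      \<open>\<phi>\<^sub>2 (T x)\<close>.\<close>
    moreover have "\<phi>\<^sub>2 (F x) = 1" "F x \<in> S2.K" using F_in[OF x] by (auto simp: state_section_def)
    ultimately show ?thesis using T_K[OF K] by simp
  qed
  ultimately show ?thesis
    unfolding projective_linear_hom_def F_def[symmetric] by blast
qed

end
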